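(* Let $\lambda$ be a complex ("spectral") parameter. The linear system for the matrix-valued function $\Psi$ $$D_z(J^{-1}\Psi)=\lambda\,\hat A_y(J^{-1}\Psi),\qquad D_{\bar y}(J^{-1}\Psi)=-\lambda\,\hat A_z(J^{-1}\Psi)$$ is a Lax pair for the SDYM3 equation $$F[J]\equiv D_{\bar y}(J^{-1}J_y)+D_z(J^{-1}J_z)=0,$$ and the solution $\Psi$ of this pair is a symmetry characteristic of SDYM3, i.e. it satisfies $$S(\Psi;J)\equiv(D_{\bar y}\hat A_y+D_z\hat A_z)(J^{-1}\Psi)=0 .$$
   Context: The independent variables are $y,z,\bar y$ (assumed complex), and $J$ is an $SL(N,\mathbb{C})$-valued function of them ($\det J=1$). $D_y,D_z,D_{\bar y}$ are the total derivatives with respect to these variables, also denoted by subscripts. $[\cdot,\cdot]$ is the matrix commutator. The covariant derivative operators act on matrix-valued functions $M$ by $$\hat A_yM=D_yM+[J^{-1}J_y,M],\qquad \hat A_zM=D_zM+[J^{-1}J_z,M].$$ "Lax pair" is used in the usual sense of a linear system for an auxiliary function $\Psi$, containing $J$ and a parameter $\lambda$, whose integrability (consistency) is tied to $J$ being a solution of the nonlinear equation $F[J]=0$. A symmetry characteristic of SDYM3 is a matrix-valued function $Q$ such that $\delta J=\alpha Q$ ($\alpha$ an infinitesimal parameter) is an infinitesimal symmetry of $F[J]=0$; the symmetry condition is the linear equation $S(Q;J)\equiv(D_{\bar y}\hat A_y+D_z\hat A_z)(J^{-1}Q)=0$, required to hold when $F[J]=0$. *)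

theory Defs
  imports "HOL-Analysis.Analysis"
begin

text \<open>
  The independent variables are a triple (y, z, yb) of complex numbers, yb standing for the
  variable written y-bar (independent of y, not its conjugate). All fields are N-by-N complex
  matrices with N = CARD('n), and are holomorphic functions on an open domain U of the space of
  triples.
\<close>

type_synonym pt = "complex \<times> complex \<times> complex"
type_synonym 'n cmat = "complex ^ 'n ^ 'n"
type_synonym 'n field_fun = "pt \<Rightarrow> 'n cmat"

definition D_y :: "'n::finite field_fun \<Rightarrow> 'n field_fun" where
  "D_y M = (\<lambda>(y, z, yb). \<chi> i j. deriv (\<lambda>t. M (t, z, yb) $ i $ j) y)"

definition D_z :: "'n::finite field_fun \<Rightarrow> 'n field_fun" where
  "D_z M = (\<lambda>(y, z, yb). \<chi> i j. deriv (\<lambda>t. M (y, t, yb) $ i $ j) z)"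

definition D_yb :: "'n::finite field_fun \<Rightarrow> 'n field_fun" where
  "D_yb M = (\<lambda>(y, z, yb). \<chi> i j. deriv (\<lambda>t. M (y, z, t) $ i $ j) yb)"

text \<open>
  Holomorphy in several variables in Osgood's form: jointly continuous, and complex
  differentiable in each variable separately. This makes every partial derivative above a genuine
  one on U, to all orders.
\<close>

definition holo_on :: "pt set \<Rightarrow> 'n::finite field_fun \<Rightarrow> bool" where
  "holo_on U M \<longleftrightarrow> continuous_on U M \<and>
     (\<forall>y z yb i j. (y, z, yb) \<in> U \<longrightarrow>
        (\<lambda>t. M (t, z, yb) $ i $ j) field_differentiable (at y) \<and>
        (\<lambda>t. M (y, t, yb) $ i $ j) field_differentiable (at z) \<and>
        (\<lambda>t. M (y, z, t) $ i $ j) field_differentiable (at yb))"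

definition SL_field_on :: "pt set \<Rightarrow> 'n::finite field_fun \<Rightarrow> bool" where
  "SL_field_on U J \<longleftrightarrow> holo_on U J \<and> (\<forall>p\<in>U. det (J p) = 1)"

definition cscale :: "complex \<Rightarrow> 'n::finite cmat \<Rightarrow> 'n cmat" where
  "cscale c M = (\<chi> i j. c * M $ i $ j)"

definition mcomm :: "'n::finite cmat \<Rightarrow> 'n cmat \<Rightarrow> 'n cmat" where
  "mcomm A B = A ** B - B ** A"

definition inv_times :: "'n::finite field_fun \<Rightarrow> 'n field_fun \<Rightarrow> 'n field_fun" where
  "inv_times J M = (\<lambda>p. matrix_inv (J p) ** M p)"

definition A_y :: "'n::finite field_fun \<Rightarrow> 'n field_fun \<Rightarrow> 'n field_fun" where
  "A_y J M = (\<lambda>p. D_y M p + mcomm (inv_times J (D_y J) p) (M p))"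

definition A_z :: "'n::finite field_fun \<Rightarrow> 'n field_fun \<Rightarrow> 'n field_fun" where
  "A_z J M = (\<lambda>p. D_z M p + mcomm (inv_times J (D_z J) p) (M p))"

definition F_SDYM3 :: "'n::finite field_fun \<Rightarrow> 'n field_fun" where
  "F_SDYM3 J = (\<lambda>p. D_yb (inv_times J (D_y J)) p + D_z (inv_times J (D_z J)) p)"

definition SDYM3_on :: "pt set \<Rightarrow> 'n::finite field_fun \<Rightarrow> bool" where
  "SDYM3_on U J \<longleftrightarrow> (\<forall>p\<in>U. F_SDYM3 J p = 0)"

definition S_sym :: "'n::finite field_fun \<Rightarrow> 'n field_fun \<Rightarrow> 'n field_fun" where
  "S_sym Q J = (\<lambda>p. D_yb (A_y J (inv_times J Q)) p + D_z (A_z J (inv_times J Q)) p)"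

text \<open>
  Q is a symmetry characteristic at J: the variation J + \<alpha>Q preserves F[J] = 0 to first
  order in \<alpha>.
\<close>

definition symmetry_characteristic_on ::
    "pt set \<Rightarrow> 'n::finite field_fun \<Rightarrow> 'n field_fun \<Rightarrow> bool" where
  "symmetry_characteristic_on U J Q \<longleftrightarrow>
     (\<forall>p\<in>U. \<forall>i j.
        ((\<lambda>\<alpha>. F_SDYM3 (\<lambda>q. J q + cscale \<alpha> (Q q)) p $ i $ j) has_field_derivative 0) (at 0))"

definition lax_system_on ::
    "complex \<Rightarrow> pt set \<Rightarrow> 'n::finite field_fun \<Rightarrow> 'n field_fun \<Rightarrow> bool" where
  "lax_system_on lam U J \<Psi> \<longleftrightarrow>
     (\<forall>p\<in>U. D_z (inv_times J \<Psi>) p = cscale lam (A_y J (inv_times J \<Psi>) p) \<and>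
            D_yb (inv_times J \<Psi>) p = cscale (- lam) (A_z J (inv_times J \<Psi>) p))"

text \<open>
  Integrability of the overdetermined linear system, in the sense of Frobenius: it imposes no
  pointwise constraint on its unknown, i.e. through every point and every prescribed matrix value
  there passes a local holomorphic solution. Asking merely for some solution would be
  trivial, as the zero function always is one.
\<close>

definition integrable_lax_system_on ::
    "complex \<Rightarrow> pt set \<Rightarrow> 'n::finite field_fun \<Rightarrow> bool" where
  "integrable_lax_system_on lam U J \<longleftrightarrow>
     (\<forall>p\<in>U. \<forall>C. \<exists>V \<Psi>. open V \<and> p \<in> V \<and> V \<subseteq> U \<and>
        holo_on V \<Psi> \<and> lax_system_on lam V J \<Psi> \<and> \<Psi> p = C)"

end

theory Submission
  imports Defs "HOL-Complex_Analysis.Cauchy_Integral_Formula"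
begin

text \<open>
  Put \<open>\<Phi> = J\<inverse>\<Psi>\<close>, \<open>a = J\<inverse>J\<^sub>y\<close>, \<open>b = J\<inverse>J\<^sub>z\<close>. In terms of the
  commuting constant vector fields \<open>X\<^sub>1 = \<partial>\<^sub>z - \<lambda>\<partial>\<^sub>y\<close> and \<open>X\<^sub>2 = \<partial>\<^sub>y\<^sub>b + \<lambda>\<partial>\<^sub>z\<close> the pair
  reads \<open>X\<^sub>1\<Phi> = \<lambda>[a, \<Phi>]\<close>, \<open>X\<^sub>2\<Phi> = -\<lambda>[b, \<Phi>]\<close>. If the second equation holds, the defect
  \<open>R = X\<^sub>1\<Phi> - \<lambda>[a, \<Phi>]\<close> of the first one satisfies \<open>X\<^sub>2R = -\<lambda>[b, R] - \<lambda>[F, \<Phi>]\<close>, the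
  quadratic terms in \<open>\<lambda>\<close> dropping out because \<open>a, b\<close> form a flat connection.

  When \<open>F = 0\<close> one solves the first equation along \<open>X\<^sub>1\<close> with constant initial value and then the
  second along \<open>X\<^sub>2\<close>, starting from that solution on a hyperplane tangent to \<open>X\<^sub>1\<close>; there \<open>R = 0\<close>,
  hence \<open>R = 0\<close> nearby by uniqueness for the homogeneous equation. Conversely, a solution with
  arbitrary value at a point forces \<open>[F, X] = 0\<close> for all \<open>X\<close>, and \<open>F\<close> is traceless as \<open>det J = 1\<close>,
  so \<open>F = 0\<close>. For \<open>\<lambda> \<noteq> 0\<close> the expression \<open>S(\<Psi>; J)\<close> is \<open>\<lambda>\<inverse>(\<Phi>\<^sub>z\<^sub>y\<^sub>b - \<Phi>\<^sub>y\<^sub>b\<^sub>z) = 0\<close>;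
  for \<open>\<lambda> = 0\<close> it equals \<open>[F, \<Phi>]\<close>.
\<close>

section \<open>Holomorphic functions of three variables\<close>

declare split_paired_All [simp del] split_paired_Ex [simp del]

section \<open>Complex lines in the space of triples and derivatives along them\<close>

definition cscaleP :: "complex \<Rightarrow> pt \<Rightarrow> pt" (infixr "*\<^sub>c" 75) where
  "c *\<^sub>c v = (c * fst v, c * fst (snd v), c * snd (snd v))"

lemma cscaleP_simps [simp]:
  "c *\<^sub>c (a, b, d) = (c * a, c * b, c * d)" "0 *\<^sub>c v = 0" "1 *\<^sub>c v = v" "c *\<^sub>c 0 = 0"
  by (simp_all add: cscaleP_def zero_prod_def)

lemma cscaleP_add_left: "(a + b) *\<^sub>c v = a *\<^sub>c v + b *\<^sub>c v"
  and cscaleP_add_right: "c *\<^sub>c (v + w) = c *\<^sub>c v + c *\<^sub>c w"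
  and cscaleP_diff_left: "(a - b) *\<^sub>c v = a *\<^sub>c v - b *\<^sub>c v"
  and cscaleP_diff_right: "c *\<^sub>c (v - w) = c *\<^sub>c v - c *\<^sub>c w"
  and cscaleP_assoc: "a *\<^sub>c b *\<^sub>c v = (a * b) *\<^sub>c v"
  by (simp_all add: cscaleP_def algebra_simps)

lemma continuous_on_cscaleP [continuous_intros]:
  assumes "continuous_on S f" "continuous_on S g"
  shows "continuous_on S (\<lambda>x. f x *\<^sub>c g x)"
  unfolding cscaleP_def by (intro continuous_intros assms)

definition dd :: "pt \<Rightarrow> (pt \<Rightarrow> complex) \<Rightarrow> pt \<Rightarrow> complex" where
  "dd v f p = deriv (\<lambda>t. f (p + t *\<^sub>c v)) 0"

text \<open>Continuity is joint, while differentiability is asked in the single direction v.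
  Holomorphy can therefore be assembled one direction at a time.\<close>

definition hol_along :: "pt set \<Rightarrow> pt \<Rightarrow> (pt \<Rightarrow> complex) \<Rightarrow> bool" where
  "hol_along U v f \<longleftrightarrow> continuous_on U f \<and> (\<forall>p\<in>U. (\<lambda>t. f (p + t *\<^sub>c v)) field_differentiable at 0)"

lemma open_line: "open U \<Longrightarrow> open {t. p + t *\<^sub>c v \<in> U}"
proof -
  assume "open U"
  moreover have "continuous_on UNIV (\<lambda>t. p + t *\<^sub>c v)" by (intro continuous_intros)
  ultimately have "open ((\<lambda>t. p + t *\<^sub>c v) -` U)" by (simp add: open_vimage)
  then show ?thesis by (simp add: vimage_def)
qed

text \<open>Every point of the line inside U may serve as a new origin, so differentiability at
  parameter 0 transfers to parameter t by a shift.\<close>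

lemma hol_along_at:
  assumes "hol_along U v f" "p + t *\<^sub>c v \<in> U"
  shows "((\<lambda>t. f (p + t *\<^sub>c v)) has_field_derivative dd v f (p + t *\<^sub>c v)) (at t)"
proof -
  have "(\<lambda>s. f (p + t *\<^sub>c v + s *\<^sub>c v)) field_differentiable at 0"
    using assms by (auto simp: hol_along_def)
  then have "((\<lambda>s. f (p + t *\<^sub>c v + s *\<^sub>c v)) has_field_derivative dd v f (p + t *\<^sub>c v)) (at 0)"
    by (simp add: dd_def DERIV_deriv_iff_field_differentiable)
  then have "((\<lambda>s. f (p + (s + t) *\<^sub>c v)) has_field_derivative dd v f (p + t *\<^sub>c v)) (at 0)"
    by (simp add: cscaleP_add_left add_ac)
  then show ?thesis
    using DERIV_shift[of "\<lambda>s. f (p + s *\<^sub>c v)" _ 0 t] by (simp add: add.commute)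
qed

lemma dd_eqI:
  "((\<lambda>t. f (p + t *\<^sub>c v)) has_field_derivative D) (at 0) \<Longrightarrow> dd v f p = D"
  by (simp add: dd_def DERIV_imp_deriv)

lemma hol_along_line:
  assumes "hol_along U v f" "\<And>t. t \<in> S \<Longrightarrow> p + t *\<^sub>c v \<in> U"
  shows "(\<lambda>t. f (p + t *\<^sub>c v)) holomorphic_on S"
  using hol_along_at[OF assms(1) assms(2)]
  unfolding holomorphic_on_def field_differentiable_def by (meson has_field_derivative_at_within)

text \<open>The preimage of U under the continuous map (q, s, t) to q + s v + t w is open and
  contains (p, 0, 0). It thus contains a product neighbourhood, and one radius serves all three
  factors.\<close>

lemma open_affine_nbhd:
  assumes "open U" "p \<in> U"
  obtains r where "r > 0"
    "\<And>q s t. dist q p < r \<Longrightarrow> norm s \<le> r \<Longrightarrow> norm t \<le> r \<Longrightarrow> q + s *\<^sub>c v + t *\<^sub>c w \<in> U"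
proof -
  let ?g = "\<lambda>x::pt \<times> complex \<times> complex. fst x + fst (snd x) *\<^sub>c v + snd (snd x) *\<^sub>c w"
  have "continuous_on UNIV ?g" by (intro continuous_intros)
  then have o: "open (?g -` U)" using assms(1) by (simp add: open_vimage)
  have m: "(p, 0, 0) \<in> ?g -` U" using assms by simp
  obtain A B where AB: "open A" "open B" "(p, 0, 0) \<in> A \<times> B" "A \<times> B \<subseteq> ?g -` U"
    by (rule open_prod_elim[OF o m])
  then have B: "(0, 0) \<in> B" by simp
  obtain C D where CD: "open C" "open D" "(0, 0) \<in> C \<times> D" "C \<times> D \<subseteq> B"
    by (rule open_prod_elim[OF AB(2) B])
  obtain a where a: "a > 0" "ball p a \<subseteq> A" using AB by (meson mem_Sigma_iff open_contains_ball)
  obtain c where c: "c > 0" "cball 0 c \<subseteq> C" using CD by (meson mem_Sigma_iff open_contains_cball)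
  obtain d where d: "d > 0" "cball 0 d \<subseteq> D" using CD by (meson mem_Sigma_iff open_contains_cball)
  define r where "r = min a (min c d)"
  have "q + s *\<^sub>c v + t *\<^sub>c w \<in> U" if "dist q p < r" "norm s \<le> r" "norm t \<le> r" for q s t
  proof -
    have "q \<in> ball p a" using that by (auto simp: r_def dist_commute)
    moreover have "s \<in> cball 0 c" "t \<in> cball 0 d" using that by (auto simp: r_def)
    ultimately have "(q, s, t) \<in> ?g -` U" using a c d AB CD by blast
    then show ?thesis by simp
  qed
  moreover have "r > 0" using a c d by (simp add: r_def)
  ultimately show ?thesis using that by blast
qed

text \<open>As q tends to p, the restrictions of f to the lines through q converge uniformly on a
  disc, by joint continuity and compactness. Derivatives of uniformly converging holomorphic
  functions converge as well.\<close>

lemma continuous_on_dd: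
  assumes "open U" "hol_along U v f"
  shows "continuous_on U (dd v f)"
proof -
  have "isCont (dd v f) p" if p: "p \<in> U" for p
  proof -
    obtain r where r: "r > 0"
      and U: "\<And>q s t. dist q p < r \<Longrightarrow> norm s \<le> r \<Longrightarrow> norm t \<le> r \<Longrightarrow> q + s *\<^sub>c v + t *\<^sub>c v \<in> U"
      using open_affine_nbhd[OF assms(1) p] by metis
    have U: "q + s *\<^sub>c v \<in> U" if "dist q p < r" "norm s \<le> r" for q s
      using U[of q s 0] that r by simp
    have cont: "continuous_on (ball p r \<times> cball 0 r) (\<lambda>x. f (fst x + snd x *\<^sub>c v))"
      by (rule continuous_on_compose2[of U f]; (intro continuous_intros)?)
         (use assms U in \<open>auto simp: hol_along_def dist_commute\<close>)
    have lim: "uniform_limit (ball 0 r) (\<lambda>q u. f (q + u *\<^sub>c v)) (\<lambda>u. f (p + u *\<^sub>c v)) (at p)"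
    proof (rule uniform_limitI)
      fix e :: real assume e: "e > 0"
      obtain X where X: "p \<in> X" "open X"
        "\<forall>q\<in>X \<inter> ball p r. \<forall>t \<in> cball 0 r. dist (f (q + t *\<^sub>c v)) (f (p + t *\<^sub>c v)) \<le> e/2"
        using continuous_on_prod_compactE[OF cont, of p "e/2"] r e by auto
      have "\<forall>\<^sub>F q in at p. q \<in> X \<inter> ball p r"
        using X r by (auto simp: eventually_at_topological intro!: exI[of _ "X \<inter> ball p r"])
      then show "\<forall>\<^sub>F q in at p. \<forall>u\<in>ball 0 r. dist (f (q + u *\<^sub>c v)) (f (p + u *\<^sub>c v)) < e"
      proof eventually_elim
        case (elim q)
        show ?case
        proof
          fix u :: complex assume "u \<in> ball 0 r"
          then have "dist (f (q + u *\<^sub>c v)) (f (p + u *\<^sub>c v)) \<le> e/2" using X elim by auto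
          then show "dist (f (q + u *\<^sub>c v)) (f (p + u *\<^sub>c v)) < e" using e by simp
        qed
      qed
    qed
    have "\<forall>\<^sub>F q in at p. (\<lambda>u. f (q + u *\<^sub>c v)) holomorphic_on ball 0 r"
      unfolding eventually_at
      by (rule exI[of _ r]) (use r U in \<open>auto intro!: hol_along_line[OF assms(2)]\<close>)
    then have "((\<lambda>q. deriv (\<lambda>u. f (q + u *\<^sub>c v)) 0) \<longlongrightarrow> deriv (\<lambda>u. f (p + u *\<^sub>c v)) 0) (at p)"
      by (intro deriv_complex_uniform_limit[OF lim]) (use r in auto)
    then show ?thesis by (simp add: isCont_def dd_def[abs_def])
  qed
  then show ?thesis by (simp add: continuous_at_imp_continuous_on)
qed

text \<open>
  The difference quotients in direction \<open>w\<close> converge uniformly, so by Weierstrass their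
  \<open>v\<close>-derivatives converge too; this yields at once the existence and the symmetry of the mixed
  derivative.
\<close>

lemma has_derivative_dd_mixed:
  assumes "open U" "hol_along U v f" "hol_along U w f" "p \<in> U"
  shows "((\<lambda>h. dd v f (p + h *\<^sub>c w)) has_field_derivative dd v (dd w f) p) (at 0)"
proof -
  obtain r where r: "r > 0"
    and U: "\<And>q s t. dist q p < r \<Longrightarrow> norm s \<le> r \<Longrightarrow> norm t \<le> r \<Longrightarrow> q + s *\<^sub>c v + t *\<^sub>c w \<in> U"
    using open_affine_nbhd[OF assms(1) assms(4)] by metis
  have U: "p + s *\<^sub>c v + t *\<^sub>c w \<in> U" if "norm s \<le> r" "norm t \<le> r" for s t
    using U[of p s t] that r by simp
  \<comment> \<open>The difference quotient in direction w, seen as a function of the position s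
    along v.\<close>
  define G where "G h s = (f (p + s *\<^sub>c v + h *\<^sub>c w) - f (p + s *\<^sub>c v)) / h" for h s
  have contw: "continuous_on U (dd w f)" by (rule continuous_on_dd) fact+
  have cont: "continuous_on (cball 0 r \<times> cball 0 r) (\<lambda>x. dd w f (p + snd x *\<^sub>c v + fst x *\<^sub>c w))"
    by (rule continuous_on_compose2[OF contw]; (intro continuous_intros)?) (use U in auto)
  have lim: "uniform_limit (ball 0 r) G (\<lambda>s. dd w f (p + s *\<^sub>c v)) (at 0)"
  proof (rule uniform_limitI)
    fix e :: real assume e: "e > 0"
    obtain X where X: "0 \<in> X" "open X"
      "\<forall>h\<in>X \<inter> cball 0 r. \<forall>s \<in> cball 0 r. dist (dd w f (p + s *\<^sub>c v + h *\<^sub>c w)) (dd w f (p + s *\<^sub>c v)) \<le> e/2"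
      using continuous_on_prod_compactE[OF cont, of 0 "e/2"] r e by auto
    obtain d where d: "d > 0" "ball 0 d \<subseteq> X" using X by (meson open_contains_ball)
    define m where "m = min d r"
    have m: "m > 0" using d r by (simp add: m_def)
    show "\<forall>\<^sub>F h in at 0. \<forall>s\<in>ball 0 r. dist (G h s) (dd w f (p + s *\<^sub>c v)) < e"
      unfolding eventually_at
    proof (intro exI[of _ m] conjI m ballI impI)
      fix h s :: complex assume h: "h \<noteq> 0 \<and> dist h 0 < m" and s: "s \<in> ball 0 r"
      let ?D = "dd w f (p + s *\<^sub>c v)"
      \<comment> \<open>With the linear part removed, the derivative is at most e/2 on the disc, so
        the mean value inequality bounds the error of the difference quotient.\<close>
      let ?k = "\<lambda>t. f (p + s *\<^sub>c v + t *\<^sub>c w) - t * ?D"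
      have "norm (?k h - ?k 0) \<le> e/2 * norm (h - 0)"
      proof (rule field_differentiable_bound[where S = "ball 0 m"])
        fix z :: complex assume z: "z \<in> ball 0 m"
        then have zr: "norm z \<le> r" "norm z < d" by (auto simp: m_def)
        have "((\<lambda>t. f (p + s *\<^sub>c v + t *\<^sub>c w)) has_field_derivative dd w f (p + s *\<^sub>c v + z *\<^sub>c w)) (at z)"
          by (rule hol_along_at[OF assms(3)]) (use U zr s in auto)
        then show "(?k has_field_derivative dd w f (p + s *\<^sub>c v + z *\<^sub>c w) - ?D) (at z within ball 0 m)"
          by (auto intro!: derivative_eq_intros intro: has_field_derivative_at_within)
        show "norm (dd w f (p + s *\<^sub>c v + z *\<^sub>c w) - ?D) \<le> e/2"
          using X(3) zr d s by (force simp: dist_norm)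
      qed (use h m in auto)
      moreover have "?k h - ?k 0 = h * (G h s - ?D)" using h by (simp add: G_def field_simps)
      ultimately have "norm (G h s - ?D) \<le> e/2"
        using h by (simp add: norm_mult mult.commute)
      then show "dist (G h s) ?D < e" using e by (simp add: dist_norm)
    qed
  qed
  have "G h holomorphic_on ball 0 r" and dG: "deriv (G h) 0 = (dd v f (p + h *\<^sub>c w) - dd v f p) / h"
    if h: "h \<noteq> 0" "norm h < r" for h
  proof -
    have *: "((\<lambda>s. f (p + h *\<^sub>c w + s *\<^sub>c v)) has_field_derivative dd v f (p + h *\<^sub>c w + s *\<^sub>c v)) (at s)"
      "((\<lambda>s. f (p + s *\<^sub>c v)) has_field_derivative dd v f (p + s *\<^sub>c v)) (at s)" if "norm s < r" for s
      using U[of s h] U[of s 0] that h r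
      by (intro hol_along_at[OF assms(2)]; simp add: add_ac)+
    have G: "(G h has_field_derivative (dd v f (p + h *\<^sub>c w + s *\<^sub>c v) - dd v f (p + s *\<^sub>c v)) / h) (at s)"
      if "norm s < r" for s
      unfolding G_def using *[OF that] h
      by (auto intro!: derivative_eq_intros simp: add_ac)
    show "G h holomorphic_on ball 0 r"
      unfolding holomorphic_on_open[OF open_ball] using G by (meson mem_ball_0)
    show "deriv (G h) 0 = (dd v f (p + h *\<^sub>c w) - dd v f p) / h"
      using G[of 0] r by (simp add: DERIV_imp_deriv)
  qed
  then have ev: "\<forall>\<^sub>F h in at 0. G h holomorphic_on ball 0 r"
    "\<forall>\<^sub>F h in at 0. deriv (G h) 0 = (dd v f (p + h *\<^sub>c w) - dd v f p) / h"
    unfolding eventually_at using r by (auto intro!: exI[of _ r])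
  have "((\<lambda>h. deriv (G h) 0) \<longlongrightarrow> deriv (\<lambda>s. dd w f (p + s *\<^sub>c v)) 0) (at 0)"
    by (rule deriv_complex_uniform_limit[OF lim ev(1)]) (use r in auto)
  then have "((\<lambda>h. (dd v f (p + h *\<^sub>c w) - dd v f p) / h) \<longlongrightarrow> dd v (dd w f) p) (at 0)"
    unfolding dd_def[of v "dd w f"] using tendsto_cong[OF ev(2)] by simp
  then show ?thesis by (simp add: DERIV_def)
qed

text \<open>A step along v + w is split into one along w starting at p and one along v starting at p
  + t w. The second starts at a moving point; joint continuity of the v-derivative makes its
  quotient converge to the value at p.\<close>

lemma has_derivative_along_add:
  assumes "open U" "hol_along U v f" "hol_along U w f" "p \<in> U"
  shows "((\<lambda>t. f (p + t *\<^sub>c (v + w))) has_field_derivative dd v f p + dd w f p) (at 0)"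
proof -
  obtain r where r: "r > 0"
    and U: "\<And>q s t. dist q p < r \<Longrightarrow> norm s \<le> r \<Longrightarrow> norm t \<le> r \<Longrightarrow> q + s *\<^sub>c v + t *\<^sub>c w \<in> U"
    using open_affine_nbhd[OF assms(1) assms(4)] by metis
  have U: "p + s *\<^sub>c v + t *\<^sub>c w \<in> U" if "norm s \<le> r" "norm t \<le> r" for s t
    using U[of p s t] that r by simp
  have contv: "continuous_on U (dd v f)" by (rule continuous_on_dd) fact+
  have cont: "continuous_on (cball 0 r \<times> cball 0 r) (\<lambda>x. dd v f (p + fst x *\<^sub>c v + snd x *\<^sub>c w))"
    by (rule continuous_on_compose2[OF contv]; (intro continuous_intros)?) (use U in auto)
  have A: "((\<lambda>t. (f (p + t *\<^sub>c v + t *\<^sub>c w) - f (p + t *\<^sub>c w)) / t - dd v f p) \<longlongrightarrow> 0) (at 0)"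
  proof (rule tendstoI)
    fix e :: real assume e: "e > 0"
    obtain d where d: "d > 0" "\<And>x. x \<in> cball 0 r \<times> cball 0 r \<Longrightarrow> dist x (0,0) < d \<Longrightarrow>
       dist (dd v f (p + fst x *\<^sub>c v + snd x *\<^sub>c w)) (dd v f p) < e/2"
      using cont[unfolded continuous_on_iff, rule_format, of "(0,0)" "e/2"] r e by auto
    \<comment> \<open>The norm of the pair (z, t) is at most the sum of the two norms, so each of
      them gets half of d.\<close>
    define m where "m = min (d/2) r"
    have m: "m > 0" using d r by (simp add: m_def)
    show "\<forall>\<^sub>F t in at 0. dist ((f (p + t *\<^sub>c v + t *\<^sub>c w) - f (p + t *\<^sub>c w)) / t - dd v f p) 0 < e"
      unfolding eventually_at
    proof (intro exI[of _ m] conjI m ballI impI)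
      fix t :: complex assume t: "t \<noteq> 0 \<and> dist t 0 < m"
      let ?D = "dd v f p"
      let ?k = "\<lambda>s. f (p + t *\<^sub>c w + s *\<^sub>c v) - s * ?D"
      have "norm (?k t - ?k 0) \<le> e/2 * norm (t - 0)"
      proof (rule field_differentiable_bound[where S = "ball 0 m"])
        fix z :: complex assume z: "z \<in> ball 0 m"
        then have zr: "norm z \<le> r" "norm t \<le> r" using t by (auto simp: m_def)
        have "dist (z, t) (0, 0) \<le> norm z + norm t"
          using norm_Pair_le[of z t] by (simp add: dist_norm)
        then have zd: "dist (z, t) (0, 0) < d" using z t by (auto simp: m_def)
        have "((\<lambda>s. f (p + t *\<^sub>c w + s *\<^sub>c v)) has_field_derivative dd v f (p + t *\<^sub>c w + z *\<^sub>c v)) (at z)"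
          by (rule hol_along_at[OF assms(2)]) (use U[of z t] zr in \<open>auto simp: add_ac\<close>)
        then show "(?k has_field_derivative dd v f (p + t *\<^sub>c w + z *\<^sub>c v) - ?D) (at z within ball 0 m)"
          by (auto intro!: derivative_eq_intros intro: has_field_derivative_at_within)
        show "norm (dd v f (p + t *\<^sub>c w + z *\<^sub>c v) - ?D) \<le> e/2"
          using d(2)[OF _ zd] zr by (auto simp: dist_norm add_ac less_imp_le)
      qed (use t m in auto)
      moreover have "?k t - ?k 0 = t * ((f (p + t *\<^sub>c v + t *\<^sub>c w) - f (p + t *\<^sub>c w)) / t - ?D)"
        using t by (simp add: field_simps add_ac)
      ultimately have "norm ((f (p + t *\<^sub>c v + t *\<^sub>c w) - f (p + t *\<^sub>c w)) / t - ?D) \<le> e/2"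
        using t by (simp add: norm_mult mult.commute)
      then show "dist ((f (p + t *\<^sub>c v + t *\<^sub>c w) - f (p + t *\<^sub>c w)) / t - ?D) 0 < e"
        using e by simp
    qed
  qed
  have "((\<lambda>t. f (p + t *\<^sub>c w)) has_field_derivative dd w f (p + 0 *\<^sub>c w)) (at 0)"
    by (rule hol_along_at[OF assms(3)]) (use assms(4) in simp)
  then have B: "((\<lambda>t. (f (p + t *\<^sub>c w) - f p) / t) \<longlongrightarrow> dd w f p) (at 0)"
    by (simp add: DERIV_def)
  have "((\<lambda>t. ((f (p + t *\<^sub>c v + t *\<^sub>c w) - f (p + t *\<^sub>c w)) / t - dd v f p) + dd v f p
          + (f (p + t *\<^sub>c w) - f p) / t) \<longlongrightarrow> 0 + dd v f p + dd w f p) (at 0)"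
    by (intro tendsto_intros A B)
  then have "((\<lambda>t. (f (p + t *\<^sub>c (v + w)) - f p) / t) \<longlongrightarrow> dd v f p + dd w f p) (at 0)"
    by (simp add: diff_divide_distrib cscaleP_add_right add_ac)
  then show ?thesis by (simp add: DERIV_def)
qed

section \<open>Functions holomorphic in every complex direction\<close>

definition hol :: "pt set \<Rightarrow> (pt \<Rightarrow> complex) \<Rightarrow> bool" where
  "hol U f \<longleftrightarrow> (\<forall>v. hol_along U v f)"

lemma hol_alongD: "hol U f \<Longrightarrow> hol_along U v f"
  unfolding hol_def by blast

lemma hol_continuous: "hol U f \<Longrightarrow> continuous_on U f"
  by (simp add: hol_def hol_along_def)

lemma hol_subset: "hol U f \<Longrightarrow> V \<subseteq> U \<Longrightarrow> hol V f"
  unfolding hol_def hol_along_def by (meson continuous_on_subset subset_iff)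

lemma hol_at:
  assumes "hol U f" "p \<in> U"
  shows "((\<lambda>t. f (p + t *\<^sub>c v)) has_field_derivative dd v f p) (at 0)"
  using hol_along_at[OF hol_alongD[OF assms(1)], of p 0 v] assms(2) by simp

lemma holI:
  assumes "continuous_on U f"
    "\<And>p v. p \<in> U \<Longrightarrow> \<exists>D. ((\<lambda>t. f (p + t *\<^sub>c v)) has_field_derivative D) (at 0)"
  shows "hol U f"
  unfolding hol_def hol_along_def field_differentiable_def using assms by blast

lemma dd_add_dir: "open U \<Longrightarrow> hol U f \<Longrightarrow> p \<in> U \<Longrightarrow> dd (v + w) f p = dd v f p + dd w f p"
  by (intro dd_eqI has_derivative_along_add) (auto dest: hol_alongD)

lemma has_derivative_along_scale:
  assumes "((\<lambda>t. f (p + t *\<^sub>c v)) has_field_derivative D) (at 0)"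
  shows "((\<lambda>t. f (p + t *\<^sub>c c *\<^sub>c v)) has_field_derivative c * D) (at 0)"
proof -
  have "((\<lambda>t. f (p + (t * c) *\<^sub>c v)) has_field_derivative D * c) (at 0)"
    by (rule DERIV_chain'[where g = "\<lambda>t. f (p + t *\<^sub>c v)" and f = "\<lambda>t. t * c"])
       (use assms in \<open>auto intro!: derivative_eq_intros\<close>)
  then show ?thesis by (simp add: cscaleP_assoc mult.commute)
qed

lemma dd_scale_dir: "hol U f \<Longrightarrow> p \<in> U \<Longrightarrow> dd (c *\<^sub>c v) f p = c * dd v f p"
  by (intro dd_eqI has_derivative_along_scale hol_at)

text \<open>Continuity of directional derivatives and existence of the mixed ones close the class
  under differentiation, hence give derivatives of all orders.\<close>

lemma hol_dd: "open U \<Longrightarrow> hol U f \<Longrightarrow> hol U (dd v f)"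
  by (rule holI; blast intro: continuous_on_dd has_derivative_dd_mixed hol_alongD)

lemma dd_commute: "open U \<Longrightarrow> hol U f \<Longrightarrow> p \<in> U \<Longrightarrow> dd v (dd w f) p = dd w (dd v f) p"
  using has_derivative_dd_mixed[of U v f w p] by (simp add: dd_eqI hol_alongD)

text \<open>The directions along which f is holomorphic are closed under sums and complex multiples,
  so the three coordinate directions generate all of them.\<close>

lemma hol_osgood:
  assumes "open U" "continuous_on U f"
    and "\<And>y z w. (y, z, w) \<in> U \<Longrightarrow> (\<lambda>t. f (t, z, w)) field_differentiable at y"
    and "\<And>y z w. (y, z, w) \<in> U \<Longrightarrow> (\<lambda>t. f (y, t, w)) field_differentiable at z"
    and "\<And>y z w. (y, z, w) \<in> U \<Longrightarrow> (\<lambda>t. f (y, z, t)) field_differentiable at w"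
  shows "hol U f"
proof -
  have split_paired_Ball: "(\<forall>p\<in>U. P p) \<longleftrightarrow> (\<forall>y z w. (y, z, w) \<in> U \<longrightarrow> P (y, z, w))" for P
    by (metis prod_cases3)
  have sh: "(\<lambda>t. g (a + t)) field_differentiable at 0" if "g field_differentiable at a"
    for g :: "complex \<Rightarrow> complex" and a
    using that DERIV_shift[of g _ 0 a] by (auto simp: field_differentiable_def add.commute)
  have sc: "hol_along U (c *\<^sub>c v) f" if "hol_along U v f" for c v
  proof -
    have "\<exists>D. ((\<lambda>t. f (p + t *\<^sub>c c *\<^sub>c v)) has_field_derivative D) (at 0)" if p: "p \<in> U" for p
    proof -
      obtain D where "((\<lambda>t. f (p + t *\<^sub>c v)) has_field_derivative D) (at 0)"
        using \<open>hol_along U v f\<close> p unfolding hol_along_def field_differentiable_def by blast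
      then show ?thesis by (blast intro: has_derivative_along_scale)
    qed
    then show ?thesis using assms(2) unfolding hol_along_def field_differentiable_def by blast
  qed
  have ad: "hol_along U (v + w) f" if "hol_along U v f" "hol_along U w f" for v w
    using has_derivative_along_add[OF assms(1) that] assms(2)
    unfolding hol_along_def field_differentiable_def by blast
  have e: "hol_along U (1,0,0) f" "hol_along U (0,1,0) f" "hol_along U (0,0,1) f"
    using sh[OF assms(3)] sh[OF assms(4)] sh[OF assms(5)] assms(2)
    by (simp_all add: hol_along_def split_paired_Ball)
  have "hol_along U v f" for v
    using ad[OF ad[OF sc[OF e(1), of "fst v"] sc[OF e(2), of "fst (snd v)"]] sc[OF e(3), of "snd (snd v)"]]
    by simp
  then show ?thesis by (simp add: hol_def)
qed

lemma hol_partials: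
  assumes "hol U f" "(y, z, w) \<in> U"
  shows "((\<lambda>t. f (t, z, w)) has_field_derivative dd (1,0,0) f (y, z, w)) (at y)"
    and "((\<lambda>t. f (y, t, w)) has_field_derivative dd (0,1,0) f (y, z, w)) (at z)"
    and "((\<lambda>t. f (y, z, t)) has_field_derivative dd (0,0,1) f (y, z, w)) (at w)"
  using hol_at[OF assms, of "(1,0,0)"] hol_at[OF assms, of "(0,1,0)"] hol_at[OF assms, of "(0,0,1)"]
    DERIV_shift[of "\<lambda>t. f (t, z, w)" _ 0 y] DERIV_shift[of "\<lambda>t. f (y, t, w)" _ 0 z]
    DERIV_shift[of "\<lambda>t. f (y, z, t)" _ 0 w]
  by (auto simp: add.commute)

lemma hol_const [simp]: "hol U (\<lambda>_. c)"
  by (intro holI continuous_intros) (auto intro: DERIV_const)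

lemma hol_add:
  assumes "hol U f" "hol U g"
  shows "hol U (\<lambda>p. f p + g p)"
  by (rule holI[OF continuous_on_add[OF assms[THEN hol_continuous]]])
     (blast intro: DERIV_add[OF hol_at[OF assms(1)] hol_at[OF assms(2)]])

lemma hol_diff:
  assumes "hol U f" "hol U g"
  shows "hol U (\<lambda>p. f p - g p)"
  by (rule holI[OF continuous_on_diff[OF assms[THEN hol_continuous]]])
     (blast intro: DERIV_diff[OF hol_at[OF assms(1)] hol_at[OF assms(2)]])

lemma hol_mult:
  assumes "hol U f" "hol U g"
  shows "hol U (\<lambda>p. f p * g p)"
  by (rule holI[OF continuous_on_mult[OF assms[THEN hol_continuous]]])
     (blast intro: DERIV_mult'[OF hol_at[OF assms(1)] hol_at[OF assms(2)]])

lemma hol_sum: "(\<And>i. i \<in> I \<Longrightarrow> hol U (f i)) \<Longrightarrow> hol U (\<lambda>p. \<Sum>i\<in>I. f i p)"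
  by (induction I rule: infinite_finite_induct) (auto intro: hol_add)

lemma hol_prod: "(\<And>i. i \<in> I \<Longrightarrow> hol U (f i)) \<Longrightarrow> hol U (\<lambda>p. \<Prod>i\<in>I. f i p)"
  by (induction I rule: infinite_finite_induct) (auto intro: hol_mult)

lemma eventually_line:
  assumes "open U" "p \<in> U"
  shows "\<forall>\<^sub>F t in nhds 0. p + t *\<^sub>c v \<in> U"
  using eventually_nhds_in_open[OF open_line[OF assms(1)], of 0 p v] assms(2) by simp

lemma hol_cong:
  assumes "open U" "\<And>p. p \<in> U \<Longrightarrow> f p = g p"
  shows "hol U f \<longleftrightarrow> hol U g"
proof -
  have "hol U g" if "hol U f" "\<And>p. p \<in> U \<Longrightarrow> f p = g p" for f g
  proof (rule holI)
    show "continuous_on U g" using hol_continuous[OF that(1)] that(2)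
      by (metis continuous_on_cong)
    show "\<exists>D. ((\<lambda>t. g (p + t *\<^sub>c v)) has_field_derivative D) (at 0)" if "p \<in> U" for p v
    proof -
      have ev: "\<forall>\<^sub>F t in nhds 0. g (p + t *\<^sub>c v) = f (p + t *\<^sub>c v)"
        using eventually_line[OF assms(1) that, of v] by (rule eventually_mono) (metis \<open>\<And>p. p \<in> U \<Longrightarrow> f p = g p\<close>)
      show ?thesis
        using DERIV_cong_ev[OF refl ev refl] hol_at[OF \<open>hol U f\<close> that] by blast
    qed
  qed
  then show ?thesis using assms(2) by metis
qed

lemma dd_cong:
  assumes "open U" "p \<in> U" "\<And>q. q \<in> U \<Longrightarrow> f q = g q"
  shows "dd v f p = dd v g p"
  unfolding dd_def
proof (rule deriv_cong_ev)
  show "\<forall>\<^sub>F t in nhds 0. f (p + t *\<^sub>c v) = g (p + t *\<^sub>c v)"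
    using eventually_line[OF assms(1,2)] by (rule eventually_mono) (rule assms(3))
qed simp

section \<open>Matrix-valued functions\<close>

lemma matrix_mul_minus_left: "(- A :: 'a::ring_1^'n^'m) ** B = - (A ** B)"
  and matrix_mul_minus_right: "(A :: 'a::ring_1^'n^'m) ** (- C) = - (A ** C)"
  by (vector matrix_matrix_mult_def sum_negf)+

lemma matrix_diff_ldistrib: "(A :: 'a::ring_1^'n^'m) ** (B - C) = A ** B - A ** C"
  and matrix_diff_rdistrib: "(D - E :: 'a::ring_1^'n^'m) ** F = D ** F - E ** F"
  by (vector matrix_matrix_mult_def sum_subtractf algebra_simps)+

lemma matrix_add_rdistrib': "(D + E :: 'a::semiring_1^'n^'m) ** F = D ** F + E ** F"
  by (vector matrix_matrix_mult_def sum.distrib algebra_simps)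

lemma cscale_nth [simp]: "cscale c M $ i $ j = c * M $ i $ j"
  by (simp add: cscale_def)

lemma cscale_mult_left: "cscale c A ** B = cscale c (A ** B)"
  and cscale_mult_right: "A ** cscale c B = cscale c (A ** B)"
  and cscale_add: "cscale c (A + B) = cscale c A + cscale c B"
  and cscale_diff: "cscale c (A - B) = cscale c A - cscale c B"
  and cscale_minus: "cscale c (- A) = - cscale c A"
  and cscale_uminus: "cscale (- c) A = - cscale c A"
  and cscale_cscale: "cscale c (cscale d A) = cscale (c * d) A"
  by (simp_all add: vec_eq_iff matrix_matrix_mult_def sum_distrib_left algebra_simps)

lemma cscale_simps [simp]: "cscale 0 A = 0" "cscale 1 A = A" "cscale c 0 = 0"
  by (simp_all add: vec_eq_iff)

lemmas matrix_ring_simps = matrix_add_ldistrib matrix_add_rdistrib' matrix_diff_ldistrib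
  matrix_diff_rdistrib matrix_mul_minus_left matrix_mul_minus_right cscale_mult_left
  cscale_mult_right cscale_add cscale_diff cscale_minus cscale_uminus cscale_cscale matrix_mul_assoc

lemma mcomm_add_left: "mcomm (A + B) C = mcomm A C + mcomm B C"
  and mcomm_cscale_left: "mcomm (cscale c A) B = cscale c (mcomm A B)"
  by (simp_all add: mcomm_def matrix_ring_simps algebra_simps)

section \<open>Entrywise derivatives of matrix curves, determinants and inverses\<close>

definition has_mderiv :: "(complex \<Rightarrow> 'n::finite cmat) \<Rightarrow> 'n cmat \<Rightarrow> complex \<Rightarrow> bool" where
  "has_mderiv M M' t \<longleftrightarrow> (\<forall>i j. ((\<lambda>s. M s $ i $ j) has_field_derivative M' $ i $ j) (at t))"

lemma has_mderiv_add: "has_mderiv M M' t \<Longrightarrow> has_mderiv N N' t \<Longrightarrow> has_mderiv (\<lambda>s. M s + N s) (M' + N') t"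
  and has_mderiv_diff: "has_mderiv M M' t \<Longrightarrow> has_mderiv N N' t \<Longrightarrow> has_mderiv (\<lambda>s. M s - N s) (M' - N') t"
  by (auto simp: has_mderiv_def intro!: derivative_eq_intros)

lemma has_mderiv_minus: "has_mderiv M M' t \<Longrightarrow> has_mderiv (\<lambda>s. - M s) (- M') t"
  and has_mderiv_const: "has_mderiv (\<lambda>s. C) 0 t"
  and has_mderiv_cscale: "has_mderiv M M' t \<Longrightarrow> has_mderiv (\<lambda>s. cscale c (M s)) (cscale c M') t"
  and has_mderiv_affine: "has_mderiv (\<lambda>s. C + cscale s D) D t"
  by (auto simp: has_mderiv_def intro!: derivative_eq_intros)

lemma has_mderiv_mult:
  "has_mderiv M M' t \<Longrightarrow> has_mderiv N N' t \<Longrightarrow> has_mderiv (\<lambda>s. M s ** N s) (M' ** N t + M t ** N') t"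
  unfolding has_mderiv_def matrix_matrix_mult_def
  by (auto intro!: derivative_eq_intros simp: sum.distrib add.commute mult.commute)

lemma has_mderiv_cong_ev:
  assumes "\<forall>\<^sub>F s in nhds t. M s = N s" "has_mderiv M M' t"
  shows "has_mderiv N M' t"
  unfolding has_mderiv_def
proof (intro allI)
  fix i j
  have "\<forall>\<^sub>F s in nhds t. M s $ i $ j = N s $ i $ j"
    using assms(1) by (rule eventually_mono) simp
  from DERIV_cong_ev[OF refl this refl]
  show "((\<lambda>s. N s $ i $ j) has_field_derivative M' $ i $ j) (at t)"
    using assms(2) unfolding has_mderiv_def by blast
qed

lemma has_mderiv_unique: "has_mderiv M M' t \<Longrightarrow> has_mderiv M M'' t \<Longrightarrow> M' = M''"
  unfolding has_mderiv_def vec_eq_iff by (meson DERIV_unique)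

lemma has_field_derivative_det:
  assumes "has_mderiv M M' t"
  shows "((\<lambda>s. det (M s)) has_field_derivative
    (\<Sum>p | p permutes UNIV. of_int (sign p) * (\<Sum>i\<in>UNIV. M' $ i $ p i * (\<Prod>j\<in>UNIV - {i}. M t $ j $ p j)))) (at t)"
  unfolding det_def
  by (intro DERIV_sum DERIV_cmult has_field_derivative_prod) (use assms in \<open>auto simp: has_mderiv_def\<close>)

text \<open>Jacobi's formula at the identity. A permutation other than \<open>id\<close> moves at
  least two points, so after omission of one factor the product still contains an off-diagonal entry
  of the identity matrix. Only the term of \<open>id\<close> survives, and it is the trace.\<close>

lemma has_field_derivative_det_mat_1:
  fixes M :: "complex \<Rightarrow> 'n::finite cmat"
  assumes "has_mderiv M M' t" "M t = mat 1"
  shows "((\<lambda>s. det (M s)) has_field_derivative trace M') (at t)"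
proof -
  let ?T = "\<lambda>p. of_int (sign p) * (\<Sum>i\<in>UNIV. M' $ i $ p i * (\<Prod>j\<in>UNIV - {i}. M t $ j $ p j))"
  have "?T p = 0" if p: "p permutes (UNIV :: 'n set)" "p \<noteq> id" for p
  proof -
    have "(\<Prod>j\<in>UNIV - {i}. M t $ j $ p j) = 0" for i
    proof -
      \<comment> \<open>If p fixes i, any moved point works. Otherwise k = p i works, since
        injectivity keeps p from fixing it.\<close>
      obtain k where k: "k \<noteq> i" "p k \<noteq> k"
      proof (cases "p i = i")
        case True then show ?thesis using p that by (metis eq_id_iff)
      next
        case False then show ?thesis using p that[of "p i"] by (metis permutes_inj injD)
      qed
      then have "M t $ k $ p k = 0" using assms(2) by (simp add: mat_def)
      then show ?thesis using k by (intro prod_zero) auto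
    qed
    then show ?thesis by (simp only: mult_zero_right sum.neutral_const)
  qed
  then have "(\<Sum>p | p permutes (UNIV :: 'n set). ?T p) = (\<Sum>p\<in>{id}. ?T p)"
    by (intro sum.mono_neutral_right) (auto simp: permutes_id finite_permutations)
  also have "\<dots> = trace M'"
    using assms(2) by (simp add: trace_def mat_def)
  finally show ?thesis using has_field_derivative_det[OF assms(1)] by simp
qed

lemma matrix_inv_det_nz:
  fixes A :: "'n::finite cmat"
  assumes "det A \<noteq> 0"
  shows "matrix_inv A ** A = mat 1" "A ** matrix_inv A = mat 1"
proof -
  have "\<exists>B. A ** B = mat 1 \<and> B ** A = mat 1"
    using assms by (simp add: invertible_det_nz[symmetric] invertible_def)
  from someI_ex[OF this] show "matrix_inv A ** A = mat 1" "A ** matrix_inv A = mat 1"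
    by (simp_all add: matrix_inv_def)
qed

text \<open>Cramer's rule for the columns of the inverse. Each entry becomes a quotient of
  determinants, from which differentiability and holomorphy of the inverse are read off.\<close>

lemma matrix_inv_cramer:
  fixes A :: "'n::finite cmat"
  assumes "det A \<noteq> 0"
  shows "matrix_inv A $ k $ j = det (\<chi> i l. if l = k then mat 1 $ i $ j else A $ i $ l) / det A"
proof -
  have "A *v column j (matrix_inv A) = column j (mat 1)"
    using matrix_inv_det_nz(2)[OF assms] by (simp add: matrix_vector_mult_def column_def vec_eq_iff matrix_matrix_mult_def)
  from this[unfolded cramer[OF assms]]
  have "column j (matrix_inv A) $ k = det (\<chi> i l. if l = k then column j (mat 1) $ i else A $ i $ l) / det A"
    by simp
  then show ?thesis unfolding column_def by (simp only: vec_lambda_beta)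
qed

text \<open>Cramer's rule yields the existence of a derivative; its value then follows by
  differentiating \<open>matrix_inv (J s) ** J s = mat 1\<close>.\<close>

lemma has_mderiv_matrix_inv:
  fixes J :: "complex \<Rightarrow> 'n::finite cmat"
  assumes J: "has_mderiv J J' t" and nz: "det (J t) \<noteq> 0"
  shows "has_mderiv (\<lambda>s. matrix_inv (J s)) (- (matrix_inv (J t) ** J' ** matrix_inv (J t))) t"
proof -
  let ?G = "\<lambda>s. matrix_inv (J s)"
  have "isCont (\<lambda>s. det (J s)) t"
    using has_field_derivative_det[OF J] by (rule DERIV_isCont)
  then have ev: "\<forall>\<^sub>F s in nhds t. det (J s) \<noteq> 0"
    using nz by (simp add: isCont_def tendsto_imp_eventually_ne eventually_nhds_conv_at)
  have "\<exists>D. ((\<lambda>s. ?G s $ k $ j) has_field_derivative D) (at t)" for k j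
  proof -
    have "has_mderiv (\<lambda>s. \<chi> i l. if l = k then mat 1 $ i $ j else J s $ i $ l)
        (\<chi> i l. if l = k then 0 else J' $ i $ l) t"
      using J by (auto simp: has_mderiv_def)
    from has_field_derivative_det[OF this] obtain D
      where D: "((\<lambda>s. det (\<chi> i l. if l = k then mat 1 $ i $ j else J s $ i $ l)) has_field_derivative D) (at t)"
      by blast
    have ev': "\<forall>\<^sub>F s in nhds t. ?G s $ k $ j = det (\<chi> i l. if l = k then mat 1 $ i $ j else J s $ i $ l) / det (J s)"
      using ev by (rule eventually_mono) (rule matrix_inv_cramer)
    show ?thesis
      using DERIV_cong_ev[OF refl ev' refl] DERIV_divide[OF D has_field_derivative_det[OF J] nz] by blast
  qed
  then obtain D where D: "\<And>k j. ((\<lambda>s. ?G s $ k $ j) has_field_derivative D k j) (at t)" by metis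
  define G' where "G' = (\<chi> k j. D k j)"
  have G: "has_mderiv ?G G' t" using D by (simp add: has_mderiv_def G'_def)
  have "\<forall>\<^sub>F s in nhds t. ?G s ** J s = mat 1"
    using ev by (rule eventually_mono) (rule matrix_inv_det_nz)
  from has_mderiv_cong_ev[OF this has_mderiv_mult[OF G J]] has_mderiv_const
  have "G' ** J t + ?G t ** J' = 0" by (rule has_mderiv_unique)
  then have "G' ** J t ** ?G t + ?G t ** J' ** ?G t = 0"
    by (metis matrix_add_rdistrib' times0_left)
  then have "G' = - (?G t ** J' ** ?G t)"
    using matrix_inv_det_nz(2)[OF nz] by (simp add: matrix_mul_assoc[symmetric] eq_neg_iff_add_eq_0)
  then show ?thesis using G by simp
qed

section \<open>Holomorphic matrix fields and their directional derivatives\<close>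

definition mhol :: "pt set \<Rightarrow> 'n::finite field_fun \<Rightarrow> bool" where
  "mhol U M \<longleftrightarrow> (\<forall>i j. hol U (\<lambda>p. M p $ i $ j))"

definition DD :: "pt \<Rightarrow> 'n::finite field_fun \<Rightarrow> 'n field_fun" where
  "DD v M p = (\<chi> i j. dd v (\<lambda>q. M q $ i $ j) p)"

text \<open>Passage between the coordinate form of holomorphy and the direction-free one: Osgood's
  lemma one way, restriction to the coordinate axes the other.\<close>

lemma holo_on_iff_mhol:
  assumes "open U"
  shows "holo_on U M \<longleftrightarrow> mhol U M"
proof
  assume M: "holo_on U M"
  show "mhol U M" unfolding mhol_def
  proof (intro allI hol_osgood assms)
    fix i j show "continuous_on U (\<lambda>p. M p $ i $ j)"
      using M by (auto simp: holo_on_def intro!: continuous_intros)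
  qed (use M in \<open>auto simp: holo_on_def\<close>)
next
  assume M: "mhol U M"
  have "continuous_on U (\<lambda>p. \<chi> i j. M p $ i $ j)"
    using M by (intro continuous_on_vec_lambda hol_continuous) (auto simp: mhol_def)
  then have c: "continuous_on U M" by simp
  have H: "hol U (\<lambda>p. M p $ i $ j)" for i j using M by (simp add: mhol_def)
  show "holo_on U M" unfolding holo_on_def field_differentiable_def
    by (intro conjI allI impI exI c) (rule hol_partials[OF H]; assumption)+
qed

lemma deriv_translate: "deriv (\<lambda>t. f (a + t)) 0 = deriv f (a :: complex)"
  unfolding deriv_def using DERIV_shift[of f _ 0 a] by (simp add: add.commute)

text \<open>Both sides apply \<open>deriv\<close> to the same function up to a shift of the
  argument, so they agree even at points where M is not differentiable.\<close>

lemma D_y_eq_DD: "D_y M = DD (1, 0, 0) M"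
  and D_z_eq_DD: "D_z M = DD (0, 1, 0) M"
  and D_yb_eq_DD: "D_yb M = DD (0, 0, 1) M"
proof -
  show "D_y M = DD (1, 0, 0) M"
  proof
    fix p :: pt
    obtain y z w where p: "p = (y, z, w)" by (cases p)
    show "D_y M p = DD (1, 0, 0) M p"
      using deriv_translate[of "\<lambda>t. M (t, z, w) $ i $ j" y for i j]
      by (simp add: p D_y_def DD_def dd_def)
  qed
  show "D_z M = DD (0, 1, 0) M"
  proof
    fix p :: pt
    obtain y z w where p: "p = (y, z, w)" by (cases p)
    show "D_z M p = DD (0, 1, 0) M p"
      using deriv_translate[of "\<lambda>t. M (y, t, w) $ i $ j" z for i j]
      by (simp add: p D_z_def DD_def dd_def)
  qed
  show "D_yb M = DD (0, 0, 1) M"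
  proof
    fix p :: pt
    obtain y z w where p: "p = (y, z, w)" by (cases p)
    show "D_yb M p = DD (0, 0, 1) M p"
      using deriv_translate[of "\<lambda>t. M (y, z, t) $ i $ j" w for i j]
      by (simp add: p D_yb_def DD_def dd_def)
  qed
qed

lemma DD_has_mderiv:
  assumes "mhol U M" "p \<in> U"
  shows "has_mderiv (\<lambda>t. M (p + t *\<^sub>c v)) (DD v M p) 0"
  unfolding has_mderiv_def
proof (intro allI)
  fix i j
  have "hol U (\<lambda>q. M q $ i $ j)" using assms(1) by (simp add: mhol_def)
  from hol_at[OF this assms(2), of v]
  show "((\<lambda>t. M (p + t *\<^sub>c v) $ i $ j) has_field_derivative DD v M p $ i $ j) (at 0)"
    by (simp add: DD_def)
qed

lemma DD_eqI: "has_mderiv (\<lambda>t. M (p + t *\<^sub>c v)) D 0 \<Longrightarrow> DD v M p = D"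
  by (auto simp: has_mderiv_def DD_def vec_eq_iff intro: dd_eqI)

lemma mhol_subset: "mhol U M \<Longrightarrow> V \<subseteq> U \<Longrightarrow> mhol V M"
  unfolding mhol_def using hol_subset by blast

lemma mhol_DD: "open U \<Longrightarrow> mhol U M \<Longrightarrow> mhol U (DD v M)"
  unfolding mhol_def DD_def by (simp add: hol_dd[unfolded])

lemma mhol_const: "mhol U (\<lambda>p. C)"
  and mhol_add: "mhol U M \<Longrightarrow> mhol U N \<Longrightarrow> mhol U (\<lambda>p. M p + N p)"
  and mhol_diff: "mhol U M \<Longrightarrow> mhol U N \<Longrightarrow> mhol U (\<lambda>p. M p - N p)"
  and mhol_cscale: "mhol U M \<Longrightarrow> mhol U (\<lambda>p. cscale c (M p))"
  and mhol_mult: "mhol U M \<Longrightarrow> mhol U N \<Longrightarrow> mhol U (\<lambda>p. M p ** N p)"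
  by (auto simp: mhol_def matrix_matrix_mult_def intro!: hol_add hol_diff hol_mult hol_sum)

lemma mhol_mcomm: "mhol U M \<Longrightarrow> mhol U N \<Longrightarrow> mhol U (\<lambda>p. mcomm (M p) (N p))"
  unfolding mcomm_def by (intro mhol_diff mhol_mult)

lemma hol_det: "mhol U M \<Longrightarrow> hol U (\<lambda>p. det (M p))"
  unfolding det_def mhol_def by (intro hol_sum hol_mult hol_prod hol_const) auto

lemma hol_divide:
  assumes "hol U f" "hol U g" "\<And>p. p \<in> U \<Longrightarrow> g p \<noteq> 0"
  shows "hol U (\<lambda>p. f p / g p)"
proof (rule holI)
  show "continuous_on U (\<lambda>p. f p / g p)"
    using assms by (intro continuous_intros hol_continuous) auto
  show "\<exists>D. ((\<lambda>t. f (p + t *\<^sub>c v) / g (p + t *\<^sub>c v)) has_field_derivative D) (at 0)" if "p \<in> U" for p v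
    by (rule exI, rule DERIV_divide[OF hol_at[OF assms(1) that] hol_at[OF assms(2) that]])
       (simp add: assms(3)[OF that])
qed

lemma mhol_matrix_inv:
  assumes "open U" "mhol U J" "\<And>p. p \<in> U \<Longrightarrow> det (J p) \<noteq> 0"
  shows "mhol U (\<lambda>p. matrix_inv (J p))"
  unfolding mhol_def
proof (intro allI)
  fix k j
  have "mhol U (\<lambda>p. \<chi> i l. if l = k then mat 1 $ i $ j else J p $ i $ l)"
    unfolding mhol_def
  proof (intro allI)
    fix i l show "hol U (\<lambda>p. (\<chi> i l. if l = k then mat 1 $ i $ j else J p $ i $ l) $ i $ l)"
      using assms(2) by (cases "l = k") (simp_all add: mhol_def)
  qed
  then have "hol U (\<lambda>p. det (\<chi> i l. if l = k then mat 1 $ i $ j else J p $ i $ l) / det (J p))"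
    by (intro hol_divide hol_det assms)
  then show "hol U (\<lambda>p. matrix_inv (J p) $ k $ j)"
    by (rule hol_cong[OF assms(1), THEN iffD1, rotated]) (simp add: matrix_inv_cramer assms(3))
qed

lemma DD_add:
  assumes "mhol U M" "mhol U N" "p \<in> U"
  shows "DD v (\<lambda>q. M q + N q) p = DD v M p + DD v N p"
  by (rule DD_eqI[OF has_mderiv_add[OF DD_has_mderiv[OF assms(1,3)] DD_has_mderiv[OF assms(2,3)]]])

lemma DD_diff:
  assumes "mhol U M" "mhol U N" "p \<in> U"
  shows "DD v (\<lambda>q. M q - N q) p = DD v M p - DD v N p"
  by (rule DD_eqI[OF has_mderiv_diff[OF DD_has_mderiv[OF assms(1,3)] DD_has_mderiv[OF assms(2,3)]]])

lemma DD_cscale: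
  assumes "mhol U M" "p \<in> U"
  shows "DD v (\<lambda>q. cscale c (M q)) p = cscale c (DD v M p)"
  by (rule DD_eqI[OF has_mderiv_cscale[OF DD_has_mderiv[OF assms]]])

lemma DD_const: "DD v (\<lambda>q. C) p = 0"
  by (intro DD_eqI has_mderiv_const)

lemma DD_mult:
  assumes "mhol U M" "mhol U N" "p \<in> U"
  shows "DD v (\<lambda>q. M q ** N q) p = DD v M p ** N p + M p ** DD v N p"
  using has_mderiv_mult[OF DD_has_mderiv[OF assms(1,3)] DD_has_mderiv[OF assms(2,3)]] by (intro DD_eqI) simp

lemma DD_mcomm:
  assumes "mhol U M" "mhol U N" "p \<in> U"
  shows "DD v (\<lambda>q. mcomm (M q) (N q)) p = mcomm (DD v M p) (N p) + mcomm (M p) (DD v N p)"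
  unfolding mcomm_def
  using assms by (simp add: DD_diff[of U] DD_mult[of U] mhol_mult)

lemma DD_matrix_inv:
  assumes "mhol U J" "p \<in> U" "det (J p) \<noteq> 0"
  shows "DD v (\<lambda>q. matrix_inv (J q)) p = - (matrix_inv (J p) ** DD v J p ** matrix_inv (J p))"
  using has_mderiv_matrix_inv[OF DD_has_mderiv[OF assms(1,2), of v]] assms(3) by (intro DD_eqI) simp

lemma DD_cong:
  assumes "open U" "p \<in> U" "\<And>q. q \<in> U \<Longrightarrow> M q = N q"
  shows "DD v M p = DD v N p"
  unfolding DD_def vec_eq_iff vec_lambda_beta
  by (intro allI dd_cong[OF assms(1,2)]) (simp add: assms(3))

lemma DD_commute: "open U \<Longrightarrow> mhol U M \<Longrightarrow> p \<in> U \<Longrightarrow> DD v (DD w M) p = DD w (DD v M) p"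
  unfolding mhol_def DD_def vec_eq_iff vec_lambda_beta by (blast intro: dd_commute)

lemma DD_add_dir: "open U \<Longrightarrow> mhol U M \<Longrightarrow> p \<in> U \<Longrightarrow> DD (v + w) M p = DD v M p + DD w M p"
  and DD_scale_dir: "mhol U M \<Longrightarrow> p \<in> U \<Longrightarrow> DD (c *\<^sub>c v) M p = cscale c (DD v M p)"
  unfolding mhol_def DD_def by (simp_all add: vec_eq_iff dd_add_dir[of U] dd_scale_dir[of U])

section \<open>Linear differential equations with holomorphic parameters\<close>

text \<open>Weierstrass's theorem on each complex line: the restrictions converge uniformly on an
  open set of parameters, so holomorphy and derivatives pass to the limit.\<close>

lemma hol_uniform_limit:
  assumes "open V" "\<And>n. hol V (h n)" "uniform_limit V h f sequentially"
  shows "hol V f" and "p \<in> V \<Longrightarrow> (\<lambda>n. dd v (h n) p) \<longlonglongrightarrow> dd v f p"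
proof -
  have line: "\<exists>A. open A \<and> 0 \<in> A \<and> uniform_limit A (\<lambda>n t. h n (p + t *\<^sub>c v)) (\<lambda>t. f (p + t *\<^sub>c v)) sequentially
      \<and> (\<forall>n. (\<lambda>t. h n (p + t *\<^sub>c v)) holomorphic_on A)" if "p \<in> V" for p v
  proof (intro exI[of _ "{t. p + t *\<^sub>c v \<in> V}"] conjI allI)
    show "open {t. p + t *\<^sub>c v \<in> V}" by (rule open_line) fact
    show "uniform_limit {t. p + t *\<^sub>c v \<in> V} (\<lambda>n t. h n (p + t *\<^sub>c v)) (\<lambda>t. f (p + t *\<^sub>c v)) sequentially"
      using assms(3) by (auto simp: uniform_limit_iff elim!: eventually_mono)
    show "(\<lambda>t. h n (p + t *\<^sub>c v)) holomorphic_on {t. p + t *\<^sub>c v \<in> V}" for n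
      by (rule hol_along_line[OF hol_alongD[OF assms(2)]]) simp
  qed (use that in simp)
  show "hol V f"
  proof (rule holI)
    show "continuous_on V f"
      by (rule uniform_limit_theorem[OF _ assms(3)]) (simp_all add: hol_continuous assms(2))
    show "\<exists>D. ((\<lambda>t. f (p + t *\<^sub>c v)) has_field_derivative D) (at 0)" if p: "p \<in> V" for p v
    proof -
      obtain A where A: "open A" "0 \<in> A"
        "uniform_limit A (\<lambda>n t. h n (p + t *\<^sub>c v)) (\<lambda>t. f (p + t *\<^sub>c v)) sequentially"
        "\<And>n. (\<lambda>t. h n (p + t *\<^sub>c v)) holomorphic_on A"
        using line[OF p] by blast
      have "(\<lambda>t. f (p + t *\<^sub>c v)) holomorphic_on A"
      proof (rule holomorphic_uniform_sequence[OF A(1) A(4)])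
        fix t assume "t \<in> A"
        then obtain d where "d > 0" "cball t d \<subseteq> A" using A(1) by (meson open_contains_cball)
        then show "\<exists>d. 0 < d \<and> cball t d \<subseteq> A \<and>
            uniform_limit (cball t d) (\<lambda>n t. h n (p + t *\<^sub>c v)) (\<lambda>t. f (p + t *\<^sub>c v)) sequentially"
          using uniform_limit_on_subset[OF A(3)] by blast
      qed
      then show ?thesis using A(1,2) by (auto simp: holomorphic_on_open)
    qed
  qed
  show "(\<lambda>n. dd v (h n) p) \<longlonglongrightarrow> dd v f p" if p: "p \<in> V"
  proof -
    obtain A where A: "open A" "0 \<in> A"
      "uniform_limit A (\<lambda>n t. h n (p + t *\<^sub>c v)) (\<lambda>t. f (p + t *\<^sub>c v)) sequentially"
      "\<And>n. (\<lambda>t. h n (p + t *\<^sub>c v)) holomorphic_on A"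
      using line[OF p] by blast
    show ?thesis
      unfolding dd_def by (rule deriv_complex_uniform_limit[OF A(3)]) (use A in auto)
  qed
qed

text \<open>The geometry of an initial value problem in direction v. The linear form l, normalised
  on v, gives the complex time l (p - p0), and time zero is the initial hyperplane through
  p0.\<close>

locale transversal =
  fixes v p0 :: pt and l :: "pt \<Rightarrow> complex"
  assumes l_add: "l (p + q) = l p + l q"
    and l_scale: "l (c *\<^sub>c p) = c * l p"
    and l_cont: "continuous_on UNIV l"
    and l_v [simp]: "l v = 1"
begin

lemma l_diff: "l (p - q) = l p - l q"
  using l_add[of "p - q" q] by simp

lemma l_0 [simp]: "l 0 = 0"
  using l_scale[of 0 0] by simp

lemma l_scaleR: "l (c *\<^sub>R p) = c *\<^sub>R l p"
proof -
  have "c *\<^sub>R p = complex_of_real c *\<^sub>c p"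
    by (simp add: cscaleP_def prod_eq_iff scaleR_conv_of_real)
  then show ?thesis by (simp add: l_scale scaleR_conv_of_real)
qed

lemma continuous_on_l [continuous_intros]: "continuous_on S f \<Longrightarrow> continuous_on S (\<lambda>x. l (f x))"
  using continuous_on_compose2[OF l_cont] by auto

text \<open>The projection along \<open>v\<close> to the hyperplane \<open>l (p - p0) = 0\<close>.\<close>

definition base :: "pt \<Rightarrow> pt" where "base p = p - l (p - p0) *\<^sub>c v"

text \<open>A product neighbourhood of \<open>p0\<close>, stable under \<open>base\<close> and under sliding along \<open>v\<close>.\<close>

definition box :: "real \<Rightarrow> pt set" where
  "box r = {p. cmod (l (p - p0)) < r \<and> norm (base p - p0) < r}"

lemma l_base [simp]: "l (base p - p0) = 0"
  by (simp add: base_def l_diff l_scale)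

lemma base_decomp: "base p + l (p - p0) *\<^sub>c v = p"
  by (simp add: base_def)

text \<open>A motion along u moves the base point along the component of u tangent to the
  hyperplane.\<close>

lemma base_line: "base (p + t *\<^sub>c u) = base p + t *\<^sub>c (u - l u *\<^sub>c v)"
  by (simp add: base_def l_diff l_add l_scale cscaleP_diff_left cscaleP_diff_right cscaleP_add_left
      cscaleP_assoc algebra_simps)

lemma base_line_v [simp]: "base (p + t *\<^sub>c v) = base p"
  by (simp add: base_line)

lemma base_base [simp]: "base (base p) = base p"
  by (simp add: base_def l_diff l_scale)

lemma l_line: "l (p + t *\<^sub>c u - p0) = l (p - p0) + t * l u"
  by (simp add: l_diff l_add l_scale)

lemma continuous_on_base [continuous_intros]: "continuous_on S f \<Longrightarrow> continuous_on S (\<lambda>x. base (f x))"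
  unfolding base_def by (intro continuous_intros)

lemma open_box: "open (box r)"
  unfolding box_def
  by (intro open_Collect_conj open_Collect_less continuous_intros)

text \<open>Both conditions bound the norm of a function that is real-affine in p. Convexity serves
  differentiation under the integral sign in \<open>hol_ray_integral\<close>.\<close>

lemma convex_box: "convex (box r)"
proof (rule convexI)
  fix p q and a b :: real
  assume pq: "p \<in> box r" "q \<in> box r" and ab: "0 \<le> a" "0 \<le> b" "a + b = 1"
  have e: "a *\<^sub>R p + b *\<^sub>R q - p0 = a *\<^sub>R (p - p0) + b *\<^sub>R (q - p0)"
    using ab(3) by (simp add: algebra_simps flip: scaleR_add_left)
  have l: "l (a *\<^sub>R p + b *\<^sub>R q - p0) = a *\<^sub>R l (p - p0) + b *\<^sub>R l (q - p0)"
    unfolding e by (simp add: l_add l_scaleR)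
  have "base (a *\<^sub>R p + b *\<^sub>R q) - p0 = (a *\<^sub>R p + b *\<^sub>R q - p0) - l (a *\<^sub>R p + b *\<^sub>R q - p0) *\<^sub>c v"
    by (simp add: base_def)
  also have "\<dots> = a *\<^sub>R (base p - p0) + b *\<^sub>R (base q - p0)"
    unfolding l unfolding e by (simp add: base_def cscaleP_def prod_eq_iff algebra_simps)
  finally have b: "base (a *\<^sub>R p + b *\<^sub>R q) - p0 = a *\<^sub>R (base p - p0) + b *\<^sub>R (base q - p0)" .
  have *: "norm (a *\<^sub>R x + b *\<^sub>R y) < r" if "norm x < r" "norm y < r" for x y :: "'z::real_normed_vector"
    using convexD[OF convex_ball, of x 0 r y a b] that ab by simp
  show "a *\<^sub>R p + b *\<^sub>R q \<in> box r"
    using pq unfolding box_def mem_Collect_eq l b by (blast intro: *)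
qed

lemma box_line: "p \<in> box r \<Longrightarrow> cmod t < r \<Longrightarrow> base p + t *\<^sub>c v \<in> box r"
  by (simp add: box_def l_line)

lemma p0_in_box [simp]: "0 < r \<Longrightarrow> p0 \<in> box r"
  by (simp add: box_def base_def)

lemma box_mono: "r \<le> s \<Longrightarrow> box r \<subseteq> box s"
  by (auto simp: box_def)

lemma box_subset:
  assumes "open U" "p0 \<in> U"
  obtains r where "r > 0" "box r \<subseteq> U"
proof -
  obtain r where r: "r > 0"
    and U: "\<And>q s t. dist q p0 < r \<Longrightarrow> norm s \<le> r \<Longrightarrow> norm t \<le> r \<Longrightarrow> q + s *\<^sub>c v + t *\<^sub>c v \<in> U"
    using open_affine_nbhd[OF assms] by metis
  have "p \<in> U" if "p \<in> box r" for p
    using U[of "base p" "l (p - p0)" 0] that r base_decomp[of p] by (simp add: box_def dist_norm)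
  then show ?thesis using that[OF r] by blast
qed

text \<open>The antiderivative along v that vanishes on the initial hyperplane. The path from
  \<open>base p\<close> to p is rescaled to the fixed interval from 0 to 1, so that p enters only
  through the prefactor and the integrand.\<close>

definition ray_integral :: "(pt \<Rightarrow> complex) \<Rightarrow> pt \<Rightarrow> complex" where
  "ray_integral f p = l (p - p0) * integral {0..1} (\<lambda>r. f (base p + (of_real r * l (p - p0)) *\<^sub>c v))"

lemma unit_scale: "p \<in> box r \<Longrightarrow> x \<in> {0..1} \<Longrightarrow> cmod (of_real x * l (p - p0)) < r"
  using mult_left_le_one_le[of "cmod (l (p - p0))" x] by (auto simp: box_def norm_mult)

lemma ray_in_box: "p \<in> box r \<Longrightarrow> x \<in> {0..1} \<Longrightarrow> base p + (of_real x * l (p - p0)) *\<^sub>c v \<in> box r"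
  by (intro box_line unit_scale)

lemma ray_continuous:
  assumes "continuous_on (box r) f" "p \<in> box r"
  shows "continuous_on {0..1} (\<lambda>x. f (base p + (of_real x * l (p - p0)) *\<^sub>c v))"
  by (rule continuous_on_compose2[OF assms(1)]; (intro continuous_intros)?) (use assms(2) ray_in_box in blast)

text \<open>When p moves along a complex line, each point of the ray moves along a complex line too,
  with a direction depending on its position. The Leibniz rule for holomorphic integrands then
  applies.\<close>

lemma hol_ray_integral:
  assumes f: "hol (box r) f"
  shows "hol (box r) (ray_integral f)"
proof (rule holI)
  have "continuous_on (box r \<times> cbox 0 (1::real)) (\<lambda>x. f (base (fst x) + (of_real (snd x) * l (fst x - p0)) *\<^sub>c v))"
    by (rule continuous_on_compose2[OF hol_continuous[OF f]]; (intro continuous_intros)?)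
       (use ray_in_box in auto)
  then have "continuous_on (box r) (\<lambda>p. integral (cbox 0 1) (\<lambda>x. f (base p + (of_real x * l (p - p0)) *\<^sub>c v)))"
    by (intro integral_continuous_on_param) (simp add: case_prod_unfold)
  then show "continuous_on (box r) (ray_integral f)"
    unfolding ray_integral_def by (intro continuous_intros) simp
  fix p u assume p: "p \<in> box r"
  define S where "S = {t. p + t *\<^sub>c u \<in> box r}"
  have S: "open S" "0 \<in> S" using open_line[OF open_box] p by (auto simp: S_def)
  have "convex S"
  proof (rule convexI)
    fix s t and a b :: real
    assume st: "s \<in> S" "t \<in> S" and ab: "0 \<le> a" "0 \<le> b" "a + b = 1"
    have "p + (a *\<^sub>R s + b *\<^sub>R t) *\<^sub>c u = (a + b) *\<^sub>R p + (a *\<^sub>R s + b *\<^sub>R t) *\<^sub>c u" using ab by simp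
    also have "\<dots> = a *\<^sub>R (p + s *\<^sub>c u) + b *\<^sub>R (p + t *\<^sub>c u)"
      by (simp add: cscaleP_def prod_eq_iff algebra_simps)
    finally show "a *\<^sub>R s + b *\<^sub>R t \<in> S"
      using convexD[OF convex_box _ _ ab] st by (simp add: S_def)
  qed
  \<comment> \<open>The velocity of the ray point at fraction x: the tangential part of u is kept,
    and its v-component is multiplied by x.\<close>
  define w where "w x = u + ((of_real x - 1) * l u) *\<^sub>c v" for x :: real
  have ray: "base (p + t *\<^sub>c u) + (of_real x * l (p + t *\<^sub>c u - p0)) *\<^sub>c v
      = base p + (of_real x * l (p - p0)) *\<^sub>c v + t *\<^sub>c w x" for t x
    by (simp only: base_line l_line w_def) (simp add: cscaleP_def prod_eq_iff algebra_simps)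
  define F where "F t x = f (base p + (of_real x * l (p - p0)) *\<^sub>c v + t *\<^sub>c w x)" for t x
  have inb: "base p + (of_real x * l (p - p0)) *\<^sub>c v + t *\<^sub>c w x \<in> box r" if "t \<in> S" "x \<in> {0..1}" for t x
    using ray_in_box[of "p + t *\<^sub>c u" r x] that by (simp add: ray S_def)
  have "(\<lambda>t. integral (cbox 0 1) (F t)) holomorphic_on S"
  proof (rule leibniz_rule_holomorphic)
    fix t and x :: real assume tx: "t \<in> S" "x \<in> cbox 0 1"
    show "((\<lambda>t. F t x) has_field_derivative
        dd u f (base p + (of_real x * l (p - p0)) *\<^sub>c v + t *\<^sub>c w x)
        + (of_real x - 1) * l u * dd v f (base p + (of_real x * l (p - p0)) *\<^sub>c v + t *\<^sub>c w x)) (at t within S)"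
    proof -
      have q: "base p + (of_real x * l (p - p0)) *\<^sub>c v + t *\<^sub>c w x \<in> box r" using inb tx by simp
      have "dd (w x) f (base p + (of_real x * l (p - p0)) *\<^sub>c v + t *\<^sub>c w x)
        = dd u f (base p + (of_real x * l (p - p0)) *\<^sub>c v + t *\<^sub>c w x)
        + (of_real x - 1) * l u * dd v f (base p + (of_real x * l (p - p0)) *\<^sub>c v + t *\<^sub>c w x)"
        using dd_add_dir[OF open_box f q] dd_scale_dir[OF f q] by (simp add: w_def)
      then show ?thesis
        using hol_along_at[OF hol_alongD[OF f] q] unfolding F_def
        by (simp add: has_field_derivative_at_within)
    qed
  next
    fix t assume "t \<in> S"
    then have "continuous_on {0..1} (F t)"
      using ray_continuous[OF hol_continuous[OF f], of "p + t *\<^sub>c u"]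
      by (simp add: ray S_def F_def[abs_def])
    then show "F t integrable_on cbox 0 1" by (simp add: integrable_continuous_interval)
  next
    have "continuous_on (S \<times> cbox 0 (1::real)) (\<lambda>x. dd u' f (base p + (of_real (snd x) * l (p - p0)) *\<^sub>c v + fst x *\<^sub>c w (snd x)))" for u'
      by (rule continuous_on_compose2[OF continuous_on_dd[OF open_box hol_alongD[OF f]]];
          (unfold w_def, intro continuous_intros)?) (use inb in \<open>auto simp: w_def\<close>)
    then show "continuous_on (S \<times> cbox 0 1) (\<lambda>(t, x).
        dd u f (base p + (of_real x * l (p - p0)) *\<^sub>c v + t *\<^sub>c w x)
        + (of_real x - 1) * l u * dd v f (base p + (of_real x * l (p - p0)) *\<^sub>c v + t *\<^sub>c w x))"
      unfolding case_prod_unfold by (intro continuous_intros)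
  qed fact
  then have "(\<lambda>t. (l (p - p0) + t * l u) * integral (cbox 0 1) (F t)) holomorphic_on S"
    by (intro holomorphic_intros)
  moreover have "(\<lambda>t. ray_integral f (p + t *\<^sub>c u)) = (\<lambda>t. (l (p - p0) + t * l u) * integral (cbox 0 1) (F t))"
    unfolding ray_integral_def ray F_def[abs_def] by (simp add: l_line)
  ultimately show "\<exists>D. ((\<lambda>t. ray_integral f (p + t *\<^sub>c u)) has_field_derivative D) (at 0)"
    using S by (simp add: holomorphic_on_open)
qed

text \<open>On the line through \<open>base p\<close> the ray integral is a contour integral over
  the segment from 0 to the time coordinate. It equals the increment of a primitive, which exists
  because a disc is convex.\<close>

lemma dd_ray_integral:
  assumes f: "hol (box r) f" and p: "p \<in> box r"
  shows "dd v (ray_integral f) p = f p"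
proof -
  define \<phi> where "\<phi> s = f (base p + s *\<^sub>c v)" for s
  have "\<phi> holomorphic_on ball 0 r"
    unfolding \<phi>_def by (rule hol_along_line[OF hol_alongD[OF f]]) (use box_line[OF p] in auto)
  then obtain g where g: "\<And>z. z \<in> ball 0 r \<Longrightarrow> (g has_field_derivative \<phi> z) (at z within ball 0 r)"
    using holomorphic_convex_primitive'[OF convex_ball open_ball] by metis
  have int: "z * integral {0..1} (\<lambda>x. \<phi> (of_real x * z)) = g z - g 0" if z: "z \<in> ball 0 r" for z
  proof -
    have "closed_segment 0 z \<subseteq> ball 0 r" using z by (intro closed_segment_subset) (auto intro: le_less_trans[OF norm_ge_zero])
    then have "(\<phi> has_contour_integral (g z - g 0)) (linepath 0 z)"
      using contour_integral_primitive[OF g, of "linepath 0 z"] by simp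
    then have "((\<lambda>x. \<phi> (linepath 0 z x) * (z - 0)) has_integral (g z - g 0)) {0..1}"
      by (simp add: has_contour_integral_linepath)
    then have "((\<lambda>x. \<phi> (of_real x * z) * z) has_integral (g z - g 0)) {0..1}"
      by (simp add: linepath_def scaleR_conv_of_real)
    from integral_unique[OF this] show ?thesis by (simp add: mult.commute)
  qed
  define c where "c = l (p - p0)"
  have c: "c \<in> ball 0 r" using p by (simp add: c_def box_def)
  have ev: "\<forall>\<^sub>F t in nhds 0. ray_integral f (p + t *\<^sub>c v) = g (c + t) - g 0"
  proof -
    have "open ((\<lambda>t. c + t) -` ball 0 r)" by (intro open_vimage open_ball continuous_intros)
    then have "\<forall>\<^sub>F t in nhds 0. t \<in> (\<lambda>t. c + t) -` ball 0 r"
      using c by (intro eventually_nhds_in_open) auto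
    then show ?thesis
      by (rule eventually_mono) (use int in \<open>auto simp: ray_integral_def \<phi>_def l_line c_def\<close>)
  qed
  have "(g has_field_derivative \<phi> c) (at (0 + c))"
    using g[OF c] c by (simp add: at_within_open[OF _ open_ball])
  then have "((\<lambda>t. g (c + t)) has_field_derivative \<phi> c) (at 0)"
    using DERIV_shift[of g "\<phi> c" 0 c] by (simp add: add.commute)
  then have "((\<lambda>t. g (c + t) - g 0) has_field_derivative \<phi> c) (at 0)"
    by (auto intro!: derivative_eq_intros)
  then have "((\<lambda>t. ray_integral f (p + t *\<^sub>c v)) has_field_derivative \<phi> c) (at 0)"
    using DERIV_cong_ev[OF refl ev refl] by blast
  then have "dd v (ray_integral f) p = \<phi> c" by (rule dd_eqI)
  then show ?thesis by (simp add: \<phi>_def c_def base_decomp)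
qed

lemma ray_integral_bound:
  assumes "continuous_on (box r) f" "\<And>q. q \<in> box r \<Longrightarrow> cmod (f q) \<le> m" "p \<in> box r" "0 \<le> m"
  shows "cmod (ray_integral f p) \<le> r * m"
proof -
  have "norm (integral {0..1} (\<lambda>x. f (base p + (of_real x * l (p - p0)) *\<^sub>c v))) \<le> m * (1 - 0)"
  proof (rule integral_bound)
    show "continuous_on {0..1} (\<lambda>x. f (base p + (of_real x * l (p - p0)) *\<^sub>c v))"
      by (rule ray_continuous[OF assms(1,3)])
    show "norm (f (base p + (of_real x * l (p - p0)) *\<^sub>c v)) \<le> m" if "x \<in> {0..1}" for x
      by (rule assms(2)[OF ray_in_box[OF assms(3) that]])
  qed simp
  moreover have "cmod (l (p - p0)) \<le> r" using assms by (simp add: box_def)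
  moreover have "0 \<le> r" using calculation(2) norm_ge_zero order_trans by blast
  ultimately show ?thesis
    unfolding ray_integral_def norm_mult by (intro mult_mono) auto
qed

section \<open>Local existence and uniqueness for linear systems along v\<close>

lemma bounded_box:
  assumes "open U" "p0 \<in> U" "continuous_on U h"
  obtains K r :: real where "K > 0" "r > 0" "box r \<subseteq> U" "\<And>p. p \<in> box r \<Longrightarrow> h p < (K::real)"
proof -
  define K where "K = \<bar>h p0\<bar> + 1"
  have "open (U \<inter> h -` {..<K})" using assms by (intro continuous_open_preimage) auto
  moreover have "p0 \<in> U \<inter> h -` {..<K}" using assms by (auto simp: K_def)
  ultimately obtain r where "r > 0" "box r \<subseteq> U \<inter> h -` {..<K}" by (rule box_subset)
  then show ?thesis using that[of K r] unfolding K_def by (simp add: subset_iff)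
qed

text \<open>
  Picard iteration. On a small box the iteration contracts by the factor 1/2, and the series of
  increments converges uniformly, hence to a function holomorphic in all variables.
\<close>

theorem linear_ode_exists:
  fixes B :: "'i::finite \<Rightarrow> 'i \<Rightarrow> pt \<Rightarrow> complex" and g :: "'i \<Rightarrow> pt \<Rightarrow> complex"
  assumes "open U" "p0 \<in> U" and B: "\<And>i j. hol U (B i j)" and g: "\<And>i. hol U (g i)"
  obtains r f where "r > 0" "box r \<subseteq> U" "\<And>i. hol (box r) (f i)"
    "\<And>i p. p \<in> box r \<Longrightarrow> dd v (f i) p = (\<Sum>j\<in>UNIV. B i j p * f j p)"
    "\<And>i p. p \<in> box r \<Longrightarrow> l (p - p0) = 0 \<Longrightarrow> f i p = g i p"
proof -
  define N where "N = real CARD('i)"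
  have N: "N \<ge> 1" by (simp add: N_def Suc_le_eq)
  have "continuous_on U (\<lambda>p. (\<Sum>i\<in>UNIV. \<Sum>j\<in>UNIV. cmod (B i j p)) + (\<Sum>i\<in>UNIV. cmod (g i p)))"
    using B g by (intro continuous_intros hol_continuous)
  then obtain K r0 where K: "K > 0" and r0: "r0 > 0" "box r0 \<subseteq> U"
    and bd: "\<And>p. p \<in> box r0 \<Longrightarrow> (\<Sum>i\<in>UNIV. \<Sum>j\<in>UNIV. cmod (B i j p)) + (\<Sum>i\<in>UNIV. cmod (g i p)) < K"
    by (rule bounded_box[OF assms(1,2)]) blast
  have sB: "cmod (B i j p) \<le> (\<Sum>i\<in>UNIV. \<Sum>j\<in>UNIV. cmod (B i j p))" for i j p
  proof -
    have "cmod (B i j p) \<le> (\<Sum>j\<in>UNIV. cmod (B i j p))" by (rule member_le_sum) auto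
    also have "\<dots> \<le> (\<Sum>i\<in>UNIV. \<Sum>j\<in>UNIV. cmod (B i j p))"
      by (rule member_le_sum[where f = "\<lambda>i. \<Sum>j\<in>UNIV. cmod (B i j p)"]) (auto intro: sum_nonneg)
    finally show ?thesis .
  qed
  have sg: "cmod (g i p) \<le> (\<Sum>i\<in>UNIV. cmod (g i p))" for i p by (rule member_le_sum) auto
  have Bb: "cmod (B i j p) \<le> K" if "p \<in> box r0" for i j p
    using bd[OF that] sB[of i j p] sum_nonneg[of UNIV "\<lambda>i. cmod (g i p)"] by simp
  have gb: "cmod (g i p) \<le> K" if "p \<in> box r0" for i p
  proof -
    have "0 \<le> (\<Sum>i\<in>UNIV. \<Sum>j\<in>UNIV. cmod (B i j p))" by (intro sum_nonneg norm_ge_zero)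
    then show ?thesis using bd[OF that] sg[of i p] by linarith
  qed
  \<comment> \<open>N * K bounds the row sums of the coefficients, and the ray integral contributes
    a factor r; this choice makes the product at most 1/2.\<close>
  define r where "r = min r0 (1 / (2 * N * K))"
  have r: "r > 0" "r \<le> r0" and rK: "r * (N * K) \<le> 1/2"
    using r0 K N by (auto simp: r_def min_def field_simps)
  have sub: "box r \<subseteq> box r0" "box r \<subseteq> U" using box_mono[OF r(2)] r0 by auto
  \<comment> \<open>These are the increments of the Picard iteration, not the iterates. The first
    one extends the initial data constantly along v.\<close>
  define F where "F = rec_nat (\<lambda>i p. g i (base p)) (\<lambda>k G i. ray_integral (\<lambda>q. \<Sum>j\<in>UNIV. B i j q * G j q))"
  have F0: "F 0 i = (\<lambda>p. g i (base p))" and FS: "F (Suc k) i = ray_integral (\<lambda>q. \<Sum>j\<in>UNIV. B i j q * F k j q)" for i k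
    by (simp_all add: F_def)
  have base_in: "base p \<in> box r" if "p \<in> box r" for p using box_line[OF that, of 0] r by simp
  have rhs: "hol (box r) (\<lambda>q. \<Sum>j\<in>UNIV. B i j q * F k j q)" if "\<And>j. hol (box r) (F k j)" for i k
    using that B sub(2) by (intro hol_sum hol_mult) (auto intro: hol_subset)
  have Fhol: "hol (box r) (F k i)" for k i
  proof (induction k arbitrary: i)
    case 0
    show ?case unfolding F0
    proof (rule holI)
      have "continuous_on (box r) (g i)" using g sub(2) by (blast intro: hol_continuous hol_subset)
      then show "continuous_on (box r) (\<lambda>p. g i (base p))"
        by (rule continuous_on_compose2; (intro continuous_intros)?) (use base_in in auto)
      show "\<exists>D. ((\<lambda>t. g i (base (p + t *\<^sub>c u))) has_field_derivative D) (at 0)" if "p \<in> box r" for p u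
        unfolding base_line using hol_at[OF g, of "base p" i "u - l u *\<^sub>c v"] base_in[OF that] sub(2) by blast
    qed
  next
    case (Suc k)
    then show ?case unfolding FS by (intro hol_ray_integral rhs)
  qed
  have Fb: "cmod (F k i p) \<le> K * (1/2) ^ k" if "p \<in> box r" for k i p
    using that
  proof (induction k arbitrary: i p)
    case 0
    then show ?case using gb[OF subsetD[OF sub(1) base_in]] by (simp add: F0)
  next
    case (Suc k)
    have "cmod (F (Suc k) i p) \<le> r * (N * (K * (K * (1/2) ^ k)))"
      unfolding FS
    proof (rule ray_integral_bound[OF hol_continuous[OF rhs[OF Fhol]] _ Suc.prems])
      fix q assume q: "q \<in> box r"
      have "cmod (\<Sum>j\<in>UNIV. B i j q * F k j q) \<le> (\<Sum>j\<in>(UNIV::'i set). K * (K * (1/2) ^ k))"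
        using Suc.IH[OF q] Bb[OF subsetD[OF sub(1) q]] K
        by (intro sum_norm_le) (auto simp: norm_mult intro!: mult_mono)
      then show "cmod (\<Sum>j\<in>UNIV. B i j q * F k j q) \<le> N * (K * (K * (1/2) ^ k))" by (simp add: N_def)
    qed (use K N in auto)
    also have "\<dots> = (r * (N * K)) * (K * (1/2) ^ k)" by simp
    also have "\<dots> \<le> 1/2 * (K * (1/2) ^ k)" using rK K by (intro mult_right_mono) auto
    finally show ?case by simp
  qed
  define f where "f i p = (\<Sum>k. F k i p)" for i p
  have geo: "summable (\<lambda>k. K * (1/2::real) ^ k)" by (intro summable_mult summable_geometric) simp
  have ul: "uniform_limit (box r) (\<lambda>n p. \<Sum>k<n. F k i p) (f i) sequentially" for i
    unfolding f_def[abs_def] by (rule Weierstrass_m_test[OF _ geo]) (use Fb in auto)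
  have hs: "hol (box r) (\<lambda>p. \<Sum>k<n. F k i p)" for n i by (intro hol_sum Fhol)
  have dF: "dd v (F (Suc k) i) p = (\<Sum>j\<in>UNIV. B i j p * F k j p)" if "p \<in> box r" for k i p
    unfolding FS by (rule dd_ray_integral[OF rhs[OF Fhol] that])
  have dF0: "dd v (F 0 i) p = 0" for i p
    unfolding F0 by (rule dd_eqI) simp
  have sums: "(\<lambda>n. \<Sum>k<n. F k i p) \<longlonglongrightarrow> f i p" if "p \<in> box r" for i p
    using tendsto_uniform_limitI[OF ul that] .
  show ?thesis
  proof (rule that[OF r(1) sub(2)])
    show "hol (box r) (f i)" for i by (rule hol_uniform_limit(1)[OF open_box hs ul])
    show "dd v (f i) p = (\<Sum>j\<in>UNIV. B i j p * f j p)" if p: "p \<in> box r" for i p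
    proof -
      have "(\<lambda>n. dd v (\<lambda>p. \<Sum>k<n. F k i p) p) \<longlonglongrightarrow> dd v (f i) p"
        by (rule hol_uniform_limit(2)[OF open_box hs ul p])
      \<comment> \<open>The shift by one matches the recursion: the increment 0 is constant along v,
        so the derivative of the partial sum up to n is the system applied to the partial sum below
        n.\<close>
      then have "(\<lambda>n. dd v (\<lambda>p. \<Sum>k<Suc n. F k i p) p) \<longlonglongrightarrow> dd v (f i) p"
        by (rule LIMSEQ_Suc)
      moreover have "dd v (\<lambda>p. \<Sum>k<Suc n. F k i p) p = (\<Sum>j\<in>UNIV. B i j p * (\<Sum>k<n. F k j p))" for n
      proof -
        have "((\<lambda>t. \<Sum>k<Suc n. F k i (p + t *\<^sub>c v)) has_field_derivative (\<Sum>k<Suc n. dd v (F k i) p)) (at 0)"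
          by (intro DERIV_sum hol_at[OF Fhol p])
        then have "dd v (\<lambda>p. \<Sum>k<Suc n. F k i p) p = (\<Sum>k<Suc n. dd v (F k i) p)" by (rule dd_eqI)
        also have "\<dots> = (\<Sum>k<n. \<Sum>j\<in>UNIV. B i j p * F k j p)"
          unfolding sum.lessThan_Suc_shift by (simp add: dF0 dF[OF p])
        also have "\<dots> = (\<Sum>j\<in>UNIV. B i j p * (\<Sum>k<n. F k j p))"
          by (subst sum.swap) (simp add: sum_distrib_left)
        finally show ?thesis .
      qed
      moreover have "(\<lambda>n. \<Sum>j\<in>UNIV. B i j p * (\<Sum>k<n. F k j p)) \<longlonglongrightarrow> (\<Sum>j\<in>UNIV. B i j p * f j p)"
        by (intro tendsto_intros sums p)
      ultimately show ?thesis using LIMSEQ_unique by simp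
    qed
    show "f i p = g i p" if "p \<in> box r" "l (p - p0) = 0" for i p
    proof -
      \<comment> \<open>At time zero the prefactor of every ray integral vanishes, so only the
        increment 0 contributes to the series.\<close>
      have "base p = p" using that(2) by (simp add: base_def)
      then have "F k i p = (if k = 0 then g i p else 0)" for k
        using that(2) by (cases k) (simp_all add: F0 FS ray_integral_def)
      then have "f i p = (\<Sum>k. if k = 0 then g i p else 0)" by (simp add: f_def)
      also have "\<dots> = g i p" using sums_single[of 0 "\<lambda>_. g i p"] by (simp add: sums_iff eq_commute)
      finally show ?thesis .
    qed
  qed
qed

text \<open>A maximum argument on a disc of complex time. Let h, the sum of the moduli of the
  components, be maximal at m. As the data vanish at time 0, the mean value inequality gives h m
  \<le> N K r h m \<le> h m / 2, so h vanishes.\<close>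

theorem linear_ode_unique:
  fixes B :: "'i::finite \<Rightarrow> 'i \<Rightarrow> pt \<Rightarrow> complex" and R :: "'i \<Rightarrow> pt \<Rightarrow> complex"
  assumes s: "s > 0" and B: "\<And>i j. hol (box s) (B i j)" and R: "\<And>i. hol (box s) (R i)"
    and ode: "\<And>i p. p \<in> box s \<Longrightarrow> dd v (R i) p = (\<Sum>j\<in>UNIV. B i j p * R j p)"
    and init: "\<And>i p. p \<in> box s \<Longrightarrow> l (p - p0) = 0 \<Longrightarrow> R i p = 0"
  obtains r where "r > 0" "r \<le> s" "\<And>i p. p \<in> box r \<Longrightarrow> R i p = 0"
proof -
  define N where "N = real CARD('i)"
  have N: "N \<ge> 1" by (simp add: N_def Suc_le_eq)
  have "continuous_on (box s) (\<lambda>p. (\<Sum>i\<in>UNIV. \<Sum>j\<in>UNIV. cmod (B i j p)))"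
    using B by (intro continuous_intros hol_continuous)
  then obtain K r0 where K: "K > 0" and r0: "r0 > 0" "box r0 \<subseteq> box s"
    and bd: "\<And>p. p \<in> box r0 \<Longrightarrow> (\<Sum>i\<in>UNIV. \<Sum>j\<in>UNIV. cmod (B i j p)) < K"
    by (rule bounded_box[OF open_box p0_in_box[OF s]]) blast
  have Bb: "cmod (B i j p) \<le> K" if "p \<in> box r0" for i j p
  proof -
    have "cmod (B i j p) \<le> (\<Sum>j\<in>UNIV. cmod (B i j p))" by (rule member_le_sum) auto
    also have "\<dots> \<le> (\<Sum>i\<in>UNIV. \<Sum>j\<in>UNIV. cmod (B i j p))"
      by (rule member_le_sum[where f = "\<lambda>i. \<Sum>j\<in>UNIV. cmod (B i j p)"]) (auto intro: sum_nonneg)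
    also have "\<dots> < K" using bd[OF that] .
    finally show ?thesis by simp
  qed
  define r where "r = min s (min r0 (1 / (2 * N * K)))"
  have r: "r > 0" "r \<le> r0" "r \<le> s" using r0 K N s by (auto simp: r_def)
  have "r \<le> 1 / (2 * N * K)" by (simp add: r_def)
  then have rK: "N * (K * r) \<le> 1/2" using K N by (simp add: field_simps)
  have sub: "box r \<subseteq> box r0" "box r \<subseteq> box s" using box_mono r by blast+
  have "R i p = 0" if p: "p \<in> box r" for i p
  proof -
    \<comment> \<open>The closed disc of this radius is compact, keeps the line inside the box, and
      has the time coordinate of p on its boundary.\<close>
    define c where "c = cmod (l (p - p0))"
    have c: "0 \<le> c" "c < r" using p by (auto simp: c_def box_def)
    define \<phi> where "\<phi> i t = R i (base p + t *\<^sub>c v)" for i t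
    have inb: "base p + t *\<^sub>c v \<in> box r" if "t \<in> cball 0 c" for t
      using box_line[OF p, of t] that c by simp
    define h where "h t = (\<Sum>i\<in>UNIV. cmod (\<phi> i t))" for t
    have "continuous_on (cball 0 c) (\<phi> i)" for i
      unfolding \<phi>_def
      by (rule continuous_on_compose2[OF hol_continuous[OF R]]; (intro continuous_intros)?)
         (use inb sub in blast)
    then have "continuous_on (cball 0 c) h" unfolding h_def by (intro continuous_intros)
    moreover have "cball (0::complex) c \<noteq> {}" using c by simp
    ultimately obtain m where m: "m \<in> cball 0 c" "\<And>t. t \<in> cball 0 c \<Longrightarrow> h t \<le> h m"
      using continuous_attains_sup[OF compact_cball] by metis
    have hm: "h m \<ge> 0" by (simp add: h_def sum_nonneg)
    have le: "cmod (\<phi> i m) \<le> K * h m * r" for i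
    proof -
      have "cmod (\<phi> i m - \<phi> i 0) \<le> K * h m * cmod (m - 0)"
      proof (rule field_differentiable_bound[where S = "cball 0 c"])
        fix t :: complex assume t: "t \<in> cball 0 c"
        let ?q = "base p + t *\<^sub>c v"
        have q: "?q \<in> box s" "?q \<in> box r0" using inb[OF t] sub by auto
        show "(\<phi> i has_field_derivative (\<Sum>j\<in>UNIV. B i j ?q * R j ?q)) (at t within cball 0 c)"
          using hol_along_at[OF hol_alongD[OF R] q(1)] ode[OF q(1)]
          unfolding \<phi>_def by (simp add: has_field_derivative_at_within)
        have "cmod (\<Sum>j\<in>UNIV. B i j ?q * R j ?q) \<le> (\<Sum>j\<in>UNIV. K * cmod (\<phi> j t))"
          using Bb[OF q(2)] by (intro sum_norm_le) (auto simp: norm_mult \<phi>_def intro!: mult_right_mono)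
        also have "\<dots> = K * h t" by (simp add: h_def sum_distrib_left)
        also have "\<dots> \<le> K * h m" using m(2)[OF t] K by simp
        finally show "cmod (\<Sum>j\<in>UNIV. B i j ?q * R j ?q) \<le> K * h m" .
      qed (use m c in auto)
      moreover have "\<phi> i 0 = 0"
        using init[of "base p" i] inb[of 0] c sub by (auto simp: \<phi>_def)
      moreover have "K * h m * cmod m \<le> K * h m * r"
        using m(1) c K hm by (intro mult_left_mono) auto
      ultimately show ?thesis by simp
    qed
    have "h m = (\<Sum>i\<in>UNIV. cmod (\<phi> i m))" by (rule h_def)
    also have "\<dots> \<le> (\<Sum>i\<in>(UNIV::'i set). K * h m * r)" by (intro sum_mono le)
    also have "\<dots> = (N * (K * r)) * h m" by (simp add: N_def)
    also have "\<dots> \<le> 1/2 * h m" using rK hm by (intro mult_right_mono) auto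
    finally have "h m = 0" using hm by simp
    then have "h (l (p - p0)) \<le> 0" using m(2)[of "l (p - p0)"] by (simp add: c_def)
    then have "h (l (p - p0)) = 0" by (simp add: h_def sum_nonneg antisym)
    then have "\<phi> i (l (p - p0)) = 0" by (simp add: h_def sum_nonneg_eq_0_iff)
    then show ?thesis by (simp add: \<phi>_def base_decomp)
  qed
  then show ?thesis using that r by blast
qed

end

section \<open>Commutator equations as linear systems\<close>

lemma mcomm_nth:
  fixes A M :: "'n::finite cmat"
  shows "mcomm A M $ i $ j = (\<Sum>q\<in>UNIV. ((if snd q = j then A $ i $ fst q else 0)
      - (if fst q = i then A $ snd q $ j else 0)) * M $ fst q $ snd q)"
proof -
  have "(\<Sum>q\<in>UNIV. ((if snd q = j then A $ i $ fst q else 0) - (if fst q = i then A $ snd q $ j else 0)) * M $ fst q $ snd q)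
    = (\<Sum>k\<in>UNIV. \<Sum>m\<in>UNIV. ((if m = j then A $ i $ k else 0) - (if k = i then A $ m $ j else 0)) * M $ k $ m)"
    unfolding UNIV_Times_UNIV[symmetric] sum.cartesian_product by (simp add: case_prod_unfold)
  also have "\<dots> = (\<Sum>k\<in>UNIV. \<Sum>m\<in>UNIV. if m = j then A $ i $ k * M $ k $ m else 0)
      - (\<Sum>k\<in>UNIV. \<Sum>m\<in>UNIV. if k = i then A $ m $ j * M $ k $ m else 0)"
    unfolding sum_subtractf[symmetric] by (intro sum.cong refl) (simp add: algebra_simps)
  also have "(\<Sum>k\<in>UNIV. \<Sum>m\<in>UNIV. if m = j then A $ i $ k * M $ k $ m else 0) = (A ** M) $ i $ j"
    by (simp add: matrix_matrix_mult_def)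
  also have "(\<Sum>k\<in>UNIV. \<Sum>m\<in>UNIV. if k = i then A $ m $ j * M $ k $ m else 0) = (M ** A) $ i $ j"
    by (subst sum.swap) (simp add: matrix_matrix_mult_def mult.commute)
  finally show ?thesis by (simp add: mcomm_def)
qed

lemma hol_mcomm_coefficient:
  "mhol U A \<Longrightarrow> hol U (\<lambda>p. (if P then A p $ i $ j else 0) - (if Q then A p $ k $ m else 0))"
  by (intro hol_diff) (cases P; cases Q; simp add: mhol_def)+

context transversal
begin

text \<open>The entries of the unknown matrix, indexed by pairs, form a vector;
  \<open>mcomm_nth\<close> displays the commutator as a linear map on it with holomorphic
  coefficients.\<close>

lemma commutator_ode_exists:
  fixes A G :: "'n::finite field_fun"
  assumes U: "open U" "p0 \<in> U" and A: "mhol U A" and G: "mhol U G"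
  obtains r M where "r > 0" "box r \<subseteq> U" "mhol (box r) M"
    "\<And>p. p \<in> box r \<Longrightarrow> DD v M p = mcomm (A p) (M p)"
    "\<And>p. p \<in> box r \<Longrightarrow> l (p - p0) = 0 \<Longrightarrow> M p = G p"
proof -
  let ?B = "\<lambda>i q p. (if snd q = snd i then A p $ fst i $ fst q else 0) - (if fst q = fst i then A p $ snd q $ snd i else 0)"
  let ?g = "\<lambda>i p. G p $ fst i $ snd i"
  have B: "hol U (?B i q)" for i q by (rule hol_mcomm_coefficient[OF A])
  have g: "hol U (?g i)" for i using G by (simp add: mhol_def)
  obtain r f where f: "r > 0" "box r \<subseteq> U" "\<And>i. hol (box r) (f i)"
    "\<And>i p. p \<in> box r \<Longrightarrow> dd v (f i) p = (\<Sum>j\<in>UNIV. ?B i j p * f j p)"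
    "\<And>i p. p \<in> box r \<Longrightarrow> l (p - p0) = 0 \<Longrightarrow> f i p = ?g i p"
    using linear_ode_exists[of U ?B ?g, OF U B g] by blast
  define M where "M p = (\<chi> i j. f (i, j) p)" for p
  show ?thesis
  proof (rule that[OF f(1,2)])
    show "mhol (box r) M" using f(3) by (simp add: mhol_def M_def)
    show "DD v M p = mcomm (A p) (M p)" if "p \<in> box r" for p
    proof -
      have "DD v M p $ i $ j = mcomm (A p) (M p) $ i $ j" for i j
        unfolding mcomm_nth DD_def M_def using f(4)[OF that, of "(i, j)"]
        by (simp only: vec_lambda_beta fst_conv snd_conv prod.collapse)
      then show ?thesis by (simp add: vec_eq_iff)
    qed
    show "M p = G p" if "p \<in> box r" "l (p - p0) = 0" for p
      using f(5)[OF that] by (simp add: vec_eq_iff M_def)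
  qed
qed

lemma commutator_ode_unique:
  fixes A R :: "'n::finite field_fun"
  assumes s: "s > 0" and A: "mhol (box s) A" and R: "mhol (box s) R"
    and ode: "\<And>p. p \<in> box s \<Longrightarrow> DD v R p = mcomm (A p) (R p)"
    and init: "\<And>p. p \<in> box s \<Longrightarrow> l (p - p0) = 0 \<Longrightarrow> R p = 0"
  obtains r where "r > 0" "r \<le> s" "\<And>p. p \<in> box r \<Longrightarrow> R p = 0"
proof -
  let ?B = "\<lambda>i q p. (if snd q = snd i then A p $ fst i $ fst q else 0) - (if fst q = fst i then A p $ snd q $ snd i else 0)"
  let ?R = "\<lambda>i p. R p $ fst i $ snd i"
  have "hol (box s) (?B i q)" for i q by (rule hol_mcomm_coefficient[OF A])
  moreover have "hol (box s) (?R i)" for i using R by (simp add: mhol_def)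
  moreover have "dd v (?R i) p = (\<Sum>j\<in>UNIV. ?B i j p * ?R j p)" if "p \<in> box s" for i p
    using arg_cong[OF ode[OF that], of "\<lambda>M. M $ fst i $ snd i"] by (simp add: mcomm_nth DD_def)
  moreover have "?R i p = 0" if "p \<in> box s" "l (p - p0) = 0" for i p using init[OF that] by simp
  ultimately obtain r where r: "r > 0" "r \<le> s" "\<And>i p. p \<in> box r \<Longrightarrow> ?R i p = 0"
    using linear_ode_unique[of s ?B ?R, OF s] by blast
  have "R p = 0" if "p \<in> box r" for p
    using r(3)[OF that, of "(i, j)" for i j] by (simp add: vec_eq_iff)
  then show ?thesis using that r by blast
qed

end

section \<open>The Lax pair\<close>

text \<open>Commuting with all elementary matrices makes F scalar, and a scalar matrix of trace zero
  vanishes.\<close>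

lemma mcomm_central_eq_0:
  fixes F :: "'n::finite cmat"
  assumes "\<And>X. mcomm F X = 0" "trace F = 0"
  shows "F = 0"
proof -
  have F: "F $ i $ k = (if i = k then F $ j $ j else 0)" for i j k
  proof -
    \<comment> \<open>The elementary matrix with its 1 in row k and column j. Entry (i, j) of the
      two products isolates one entry of F on each side.\<close>
    let ?E = "(\<chi> a b. if a = k \<and> b = j then 1 else 0) :: 'n cmat"
    have "mcomm F ?E $ i $ j = 0" by (simp add: assms(1))
    moreover have "(F ** ?E) $ i $ j = F $ i $ k"
      by (simp add: matrix_matrix_mult_def if_distrib cong: if_cong)
    moreover have "(?E ** F) $ i $ j = (if i = k then F $ j $ j else 0)"
      by (simp add: matrix_matrix_mult_def if_distrib if_distribR cong: if_cong)
    ultimately show ?thesis by (simp add: mcomm_def)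
  qed
  have "F $ j $ j = 0" for j
  proof -
    have "trace F = (\<Sum>i\<in>(UNIV :: 'n set). F $ j $ j)"
      unfolding trace_def by (intro sum.cong refl) (subst F[of _ _ j], simp)
    then show ?thesis using assms(2) by simp
  qed
  then have "F $ i $ k = 0" for i k using F[of i k i] by simp
  then show ?thesis by (simp add: vec_eq_iff)
qed

section \<open>The connection \<open>J^{-1} dJ\<close>: flatness and vanishing trace\<close>

abbreviation "e_y \<equiv> (1, 0, 0) :: pt"
abbreviation "e_z \<equiv> (0, 1, 0) :: pt"
abbreviation "e_yb \<equiv> (0, 0, 1) :: pt"

lemma inv_times_eq: "inv_times J M = (\<lambda>p. matrix_inv (J p) ** M p)"
  by (simp add: inv_times_def fun_eq_iff)

context
  fixes U :: "pt set" and J :: "'n::finite field_fun"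
  assumes U: "open U" and J: "SL_field_on U J"
begin

lemma mhol_J: "mhol U J"
  using J U by (simp add: SL_field_on_def holo_on_iff_mhol)

lemma det_J: "p \<in> U \<Longrightarrow> det (J p) = 1"
  using J by (simp add: SL_field_on_def)

lemma J_inv: "p \<in> U \<Longrightarrow> matrix_inv (J p) ** J p = mat 1" "p \<in> U \<Longrightarrow> J p ** matrix_inv (J p) = mat 1"
  by (simp_all add: matrix_inv_det_nz det_J)

lemma mhol_J_inv: "mhol U (\<lambda>p. matrix_inv (J p))"
  by (rule mhol_matrix_inv[OF U mhol_J]) (simp add: det_J)

lemma mhol_inv_times: "mhol U M \<Longrightarrow> mhol U (inv_times J M)"
  unfolding inv_times_eq by (intro mhol_mult mhol_J_inv)

lemma mhol_conn: "mhol U (inv_times J (DD v J))"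
  by (intro mhol_inv_times mhol_DD U mhol_J)

lemma DD_J_inv: "p \<in> U \<Longrightarrow> DD v (\<lambda>q. matrix_inv (J q)) p = - (matrix_inv (J p) ** DD v J p ** matrix_inv (J p))"
  by (rule DD_matrix_inv[OF mhol_J]) (simp_all add: det_J)

lemma DD_inv_times:
  assumes "mhol U M" "p \<in> U"
  shows "DD v (inv_times J M) p = matrix_inv (J p) ** DD v M p - inv_times J (DD v J) p ** inv_times J M p"
  using DD_mult[OF mhol_J_inv assms] DD_J_inv[OF assms(2)]
  by (simp add: inv_times_eq matrix_mul_minus_left matrix_mul_assoc)

text \<open>Zero curvature of a pure gauge connection; it expresses the equality of the mixed
  derivatives of J.\<close>

lemma flat_connection:
  assumes "p \<in> U"
  shows "DD w (inv_times J (DD v J)) p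
    = DD v (inv_times J (DD w J)) p + mcomm (inv_times J (DD v J) p) (inv_times J (DD w J) p)"
  using DD_inv_times[OF mhol_DD[OF U mhol_J] assms, of w v] DD_inv_times[OF mhol_DD[OF U mhol_J] assms, of v w]
    DD_commute[OF U mhol_J assms, of v w]
  by (simp add: mcomm_def)

text \<open>With the inverse frozen at p, the curve
  \<open>matrix_inv (J p) ** J (p + t *\<^sub>c v)\<close> passes through the identity and has
  constant determinant. Jacobi's formula turns this into a vanishing trace.\<close>

lemma trace_conn:
  assumes "p \<in> U"
  shows "trace (inv_times J (DD v J) p) = 0"
proof -
  let ?M = "\<lambda>t. matrix_inv (J p) ** J (p + t *\<^sub>c v)"
  have "has_mderiv ?M (inv_times J (DD v J) p) 0"
    using has_mderiv_mult[OF has_mderiv_const DD_has_mderiv[OF mhol_J assms], of "matrix_inv (J p)" v]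
    by (simp add: inv_times_eq)
  then have 1: "((\<lambda>t. det (?M t)) has_field_derivative trace (inv_times J (DD v J) p)) (at 0)"
    by (rule has_field_derivative_det_mat_1) (simp add: J_inv assms)
  have "\<forall>\<^sub>F t in nhds 0. det (?M t) = det (matrix_inv (J p))"
    using eventually_line[OF U assms, of v] by (rule eventually_mono) (simp add: det_mul det_J)
  then have "((\<lambda>t. det (?M t)) has_field_derivative 0) (at 0)"
    using DERIV_cong_ev[OF refl _ refl, of "\<lambda>t. det (?M t)" "\<lambda>t. det (matrix_inv (J p))" 0 0] by simp
  with 1 show ?thesis by (rule DERIV_unique)
qed

lemma trace_DD_conn:
  assumes "p \<in> U"
  shows "trace (DD w (inv_times J (DD v J)) p) = 0"
proof -
  have "((\<lambda>t. \<Sum>i\<in>UNIV. inv_times J (DD v J) (p + t *\<^sub>c w) $ i $ i) has_field_derivative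
      (\<Sum>i\<in>UNIV. DD w (inv_times J (DD v J)) p $ i $ i)) (at 0)"
    by (intro DERIV_sum) (use DD_has_mderiv[OF mhol_conn assms] in \<open>simp add: has_mderiv_def\<close>)
  then have "dd w (\<lambda>q. trace (inv_times J (DD v J) q)) p = trace (DD w (inv_times J (DD v J)) p)"
    unfolding trace_def by (rule dd_eqI)
  moreover have "dd w (\<lambda>q. trace (inv_times J (DD v J) q)) p = dd w (\<lambda>q. 0) p"
    by (rule dd_cong[OF U assms]) (rule trace_conn)
  moreover have "dd w (\<lambda>q. 0) p = 0" by (rule dd_eqI) simp
  ultimately show ?thesis by simp
qed

section \<open>The pair as two equations along constant directions\<close>

lemma DD_X1: "V \<subseteq> U \<Longrightarrow> open V \<Longrightarrow> mhol V M \<Longrightarrow> p \<in> V \<Longrightarrow> DD (- lam, 1, 0) M p = DD e_z M p - cscale lam (DD e_y M p)"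
  using DD_add_dir[of V M p "(- lam) *\<^sub>c e_y" e_z] DD_scale_dir[of V M p "- lam" e_y]
  by (simp add: cscale_uminus)

lemma DD_X2: "V \<subseteq> U \<Longrightarrow> open V \<Longrightarrow> mhol V M \<Longrightarrow> p \<in> V \<Longrightarrow> DD (0, lam, 1) M p = DD e_yb M p + cscale lam (DD e_z M p)"
  using DD_add_dir[of V M p "lam *\<^sub>c e_z" e_yb] DD_scale_dir[of V M p "lam" e_z]
  by (simp add: add.commute)

abbreviation (input) "conn_y \<equiv> inv_times J (DD e_y J)"
abbreviation (input) "conn_z \<equiv> inv_times J (DD e_z J)"

lemma lax_system_iff:
  assumes V: "open V" "V \<subseteq> U" and M: "mhol V (inv_times J \<Psi>)"
  shows "lax_system_on lam V J \<Psi> \<longleftrightarrow> (\<forall>p\<in>V.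
    DD (- lam, 1, 0) (inv_times J \<Psi>) p = mcomm (cscale lam (conn_y p)) (inv_times J \<Psi> p) \<and>
    DD (0, lam, 1) (inv_times J \<Psi>) p = mcomm (cscale (- lam) (conn_z p)) (inv_times J \<Psi> p))"
proof -
  have "x = cscale lam (y + c) \<longleftrightarrow> x - cscale lam y = cscale lam c" for x y c :: "'n cmat"
    by (simp add: cscale_add diff_eq_eq add.commute)
  moreover have "x = cscale (- lam) (y + c) \<longleftrightarrow> x + cscale lam y = cscale (- lam) c" for x y c :: "'n cmat"
    by (simp only: cscale_uminus) (simp only: cscale_add eq_neg_iff_add_eq_0 add.assoc)
  ultimately show ?thesis
    unfolding lax_system_on_def A_y_def A_z_def D_y_eq_DD D_z_eq_DD D_yb_eq_DD mcomm_cscale_left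
    by (simp only: DD_X1[where lam = lam, OF V(2,1) M] DD_X2[where lam = lam, OF V(2,1) M] cong: ball_cong)
qed

lemma F_SDYM3_eq: "F_SDYM3 J p = DD e_yb conn_y p + DD e_z conn_z p"
  by (simp add: F_SDYM3_def D_y_eq_DD D_z_eq_DD D_yb_eq_DD)

lemma lax_curvature:
  assumes V: "open V" "V \<subseteq> U" and M: "mhol V M" and p: "p \<in> V"
    and X2: "\<And>q. q \<in> V \<Longrightarrow> DD (0, lam, 1) M q = mcomm (cscale (- lam) (conn_z q)) (M q)"
  defines "R \<equiv> \<lambda>q. DD (- lam, 1, 0) M q - mcomm (cscale lam (conn_y q)) (M q)"
  shows "DD (0, lam, 1) R p
    = mcomm (cscale (- lam) (conn_z p)) (R p) - cscale lam (mcomm (F_SDYM3 J p) (M p))"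
proof -
  let ?X1 = "(- lam, 1, 0) :: pt" and ?X2 = "(0, lam, 1) :: pt"
  have pU: "p \<in> U" using p V by blast
  have a: "mhol V conn_y" "mhol V conn_z" using mhol_conn V(2) mhol_subset by blast+
  have "DD ?X2 R p = DD ?X2 (DD ?X1 M) p - DD ?X2 (\<lambda>q. mcomm (cscale lam (conn_y q)) (M q)) p"
    unfolding R_def by (intro DD_diff[OF _ _ p] mhol_DD V mhol_mcomm mhol_cscale a M)
  \<comment> \<open>The two constant directions commute, and the second equation holds on all of V,
    so it may be differentiated.\<close>
  also have "DD ?X2 (DD ?X1 M) p = DD ?X1 (\<lambda>q. mcomm (cscale (- lam) (conn_z q)) (M q)) p"
    unfolding DD_commute[OF V(1) M p, of ?X2] by (rule DD_cong[OF V(1) p X2])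
  also have "\<dots> = mcomm (cscale (- lam) (DD e_z conn_z p - cscale lam (DD e_y conn_z p))) (M p)
      + mcomm (cscale (- lam) (conn_z p)) (DD ?X1 M p)"
    by (simp add: DD_mcomm[OF mhol_cscale[OF a(2)] M p] DD_cscale[OF a(2) p] DD_X1[where lam = lam, OF V(2,1) a(2) p])
  also have "DD ?X2 (\<lambda>q. mcomm (cscale lam (conn_y q)) (M q)) p
     = mcomm (cscale lam (DD e_yb conn_y p + cscale lam (DD e_z conn_y p))) (M p)
      + mcomm (cscale lam (conn_y p)) (mcomm (cscale (- lam) (conn_z p)) (M p))"
    by (simp add: DD_mcomm[OF mhol_cscale[OF a(1)] M p] DD_cscale[OF a(1) p] DD_X2[where lam = lam, OF V(2,1) a(1) p] X2[OF p])
  \<comment> \<open>Flatness reduces the terms quadratic in \<open>lam\<close> to double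
    commutators, which match those inside \<open>mcomm (cscale (- lam) (conn_z p)) (R p)\<close> by
    the Jacobi identity.\<close>
  also have "DD e_z conn_y p = DD e_y conn_z p + mcomm (conn_y p) (conn_z p)"
    by (rule flat_connection[OF pU])
  finally show ?thesis
    unfolding R_def F_SDYM3_eq by (simp add: mcomm_def matrix_ring_simps algebra_simps)
qed

lemma integrable_of_SDYM3:
  assumes F: "SDYM3_on U J"
  shows "integrable_lax_system_on lam U J"
  unfolding integrable_lax_system_on_def
proof (intro ballI allI)
  fix p C assume p: "p \<in> U"
  interpret X1: transversal "(- lam, 1, 0)" p "\<lambda>q. fst (snd q)"
    by standard (auto simp: cscaleP_def intro!: continuous_intros)
  \<comment> \<open>The initial hyperplane of the second direction fixes the coordinate yb. It
    contains the first direction, whose yb-component is 0.\<close>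
  interpret X2: transversal "(0, lam, 1)" p "\<lambda>q. snd (snd q)"
    by standard (auto simp: cscaleP_def intro!: continuous_intros)
  have ay: "mhol U (\<lambda>q. cscale lam (conn_y q))" and az: "mhol U (\<lambda>q. cscale (- lam) (conn_z q))"
    by (intro mhol_cscale mhol_conn)+
  \<comment> \<open>The initial value is chosen so that J p times it equals C.\<close>
  obtain r1 M1 where M1: "r1 > 0" "X1.box r1 \<subseteq> U" "mhol (X1.box r1) M1"
    "\<And>q. q \<in> X1.box r1 \<Longrightarrow> DD (- lam, 1, 0) M1 q = mcomm (cscale lam (conn_y q)) (M1 q)"
    "\<And>q. q \<in> X1.box r1 \<Longrightarrow> fst (snd (q - p)) = 0 \<Longrightarrow> M1 q = matrix_inv (J p) ** C"
    using X1.commutator_ode_exists[OF U p ay mhol_const[of U "matrix_inv (J p) ** C"]] by metis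
  obtain r2 M where M: "r2 > 0" "X2.box r2 \<subseteq> X1.box r1" "mhol (X2.box r2) M"
    "\<And>q. q \<in> X2.box r2 \<Longrightarrow> DD (0, lam, 1) M q = mcomm (cscale (- lam) (conn_z q)) (M q)"
    "\<And>q. q \<in> X2.box r2 \<Longrightarrow> snd (snd (q - p)) = 0 \<Longrightarrow> M q = M1 q"
    using X2.commutator_ode_exists[OF X1.open_box X1.p0_in_box[OF M1(1)] mhol_subset[OF az M1(2)] M1(3)] by metis
  let ?B = "X2.box r2"
  have BU: "?B \<subseteq> U" using M M1 by blast
  define R where "R q = DD (- lam, 1, 0) M q - mcomm (cscale lam (conn_y q)) (M q)" for q
  have "mhol ?B R"
    unfolding R_def[abs_def]
    by (intro mhol_diff mhol_mcomm mhol_DD X2.open_box M(3) mhol_subset[OF ay BU])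
  moreover have "DD (0, lam, 1) R q = mcomm (cscale (- lam) (conn_z q)) (R q)" if q: "q \<in> ?B" for q
    using lax_curvature[OF X2.open_box BU M(3) q M(4)] F q BU
    by (simp add: R_def[abs_def] SDYM3_on_def subset_iff mcomm_def)
  moreover have "R q = 0" if q: "q \<in> ?B" "snd (snd (q - p)) = 0" for q
  proof -
    \<comment> \<open>The line through q in the first direction stays in the hyperplane, where M and
      M1 agree. Hence their derivatives in this direction agree at q, and M inherits the first
      equation there.\<close>
    have ev: "\<forall>\<^sub>F t in nhds 0. M1 (q + t *\<^sub>c (- lam, 1, 0)) = M (q + t *\<^sub>c (- lam, 1, 0))"
      using eventually_line[OF X2.open_box q(1), of "(- lam, 1, 0)"]
      by (rule eventually_mono) (use M(5) q(2) in \<open>simp add: cscaleP_def\<close>)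
    have "q \<in> X1.box r1" using q M(2) by blast
    from has_mderiv_cong_ev[OF ev DD_has_mderiv[OF M1(3) this]]
    have "DD (- lam, 1, 0) M q = DD (- lam, 1, 0) M1 q" by (rule DD_eqI)
    then show ?thesis using M1(4)[OF \<open>q \<in> X1.box r1\<close>] M(5)[OF q] by (simp add: R_def)
  qed
  ultimately obtain r where r: "r > 0" "r \<le> r2" "\<And>q. q \<in> X2.box r \<Longrightarrow> R q = 0"
    using X2.commutator_ode_unique[OF M(1) mhol_subset[OF az BU]] by metis
  let ?V = "X2.box r"
  have VB: "?V \<subseteq> ?B" by (rule X2.box_mono[OF r(2)])
  then have VU: "?V \<subseteq> U" using BU by blast
  define \<Psi> where "\<Psi> q = J q ** M q" for q
  have \<Psi>: "inv_times J \<Psi> q = M q" if "q \<in> ?V" for q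
    using J_inv(1)[of q] that VU by (auto simp: inv_times_def \<Psi>_def matrix_mul_assoc)
  have MV: "mhol ?V M" by (rule mhol_subset[OF M(3) VB])
  have "mhol ?V \<Psi>" unfolding \<Psi>_def[abs_def] by (intro mhol_mult MV mhol_subset[OF mhol_J VU])
  have "mhol ?V (inv_times J \<Psi>)"
    unfolding inv_times_eq by (intro mhol_mult mhol_subset[OF mhol_J_inv VU]) fact
  moreover have "DD w (inv_times J \<Psi>) q = DD w M q" if "q \<in> ?V" for q w
    by (rule DD_cong[OF X2.open_box that \<Psi>])
  ultimately have "lax_system_on lam ?V J \<Psi>"
    using r(3) M(4) VB by (subst lax_system_iff[OF X2.open_box VU]) (auto simp: \<Psi> R_def subset_iff)
  moreover have "\<Psi> p = C"
    using M(5)[of p] M1(5)[of p] M(1) M1(1) J_inv(2)[OF p] by (simp add: \<Psi>_def matrix_mul_assoc)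
  ultimately show "\<exists>V \<Psi>. open V \<and> p \<in> V \<and> V \<subseteq> U \<and> holo_on V \<Psi> \<and> lax_system_on lam V J \<Psi> \<and> \<Psi> p = C"
    using X2.open_box VU X2.p0_in_box[OF r(1)] \<open>mhol ?V \<Psi>\<close> holo_on_iff_mhol[OF X2.open_box] by blast
qed

lemma SDYM3_of_integrable:
  assumes "lam \<noteq> 0" and I: "integrable_lax_system_on lam U J"
  shows "SDYM3_on U J"
  unfolding SDYM3_on_def
proof
  fix p assume p: "p \<in> U"
  have "mcomm (F_SDYM3 J p) X = 0" for X
  proof -
    \<comment> \<open>The prescribed value \<open>J p ** X\<close> makes
      \<open>inv_times J \<Psi>\<close> equal to X at p.\<close>
    obtain V \<Psi> where V: "open V" "p \<in> V" "V \<subseteq> U" and \<Psi>: "holo_on V \<Psi>" "lax_system_on lam V J \<Psi>" "\<Psi> p = J p ** X"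
      using I p unfolding integrable_lax_system_on_def by metis
    let ?M = "inv_times J \<Psi>"
    have M: "mhol V ?M"
      unfolding inv_times_eq
      by (intro mhol_mult mhol_subset[OF mhol_J_inv V(3)]) (use \<Psi> V holo_on_iff_mhol in blast)
    have lax: "DD (- lam, 1, 0) ?M q = mcomm (cscale lam (conn_y q)) (?M q)"
      "DD (0, lam, 1) ?M q = mcomm (cscale (- lam) (conn_z q)) (?M q)" if "q \<in> V" for q
      using \<Psi>(2) that unfolding lax_system_iff[OF V(1,3) M] by blast+
    \<comment> \<open>The defect of the first equation is identically zero on V, so its derivative
      vanishes and \<open>lax_curvature\<close> leaves only the commutator with
      \<open>F_SDYM3 J p\<close>.\<close>
    have "DD (0, lam, 1) (\<lambda>q. DD (- lam, 1, 0) ?M q - mcomm (cscale lam (conn_y q)) (?M q)) p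
       = DD (0, lam, 1) (\<lambda>q. 0) p"
      by (rule DD_cong[OF V(1,2)]) (simp add: lax)
    then have "cscale lam (mcomm (F_SDYM3 J p) (?M p)) = 0"
      using lax_curvature[OF V(1,3) M V(2) lax(2)] lax(1)[OF V(2)]
      by (simp add: DD_const mcomm_def)
    moreover have "?M p = X" using J_inv(1)[OF p] \<Psi>(3) by (simp add: inv_times_eq matrix_mul_assoc)
    ultimately show ?thesis using \<open>lam \<noteq> 0\<close> by (simp add: vec_eq_iff)
  qed
  moreover have "trace (F_SDYM3 J p) = 0"
    unfolding F_SDYM3_eq by (simp add: trace_add trace_DD_conn[OF p])
  ultimately show "F_SDYM3 J p = 0" by (rule mcomm_central_eq_0)
qed

section \<open>The symmetry condition and the first variation of the equation\<close>

lemma S_sym_eq_0: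
  assumes \<Psi>: "mhol U \<Psi>" "lax_system_on lam U J \<Psi>" and or: "lam \<noteq> 0 \<or> SDYM3_on U J" and p: "p \<in> U"
  shows "S_sym \<Psi> J p = 0"
proof -
  let ?M = "inv_times J \<Psi>"
  have M: "mhol U ?M" by (rule mhol_inv_times) fact
  have lax: "DD e_z ?M q = cscale lam (A_y J ?M q)" "DD e_yb ?M q = cscale (- lam) (A_z J ?M q)" if "q \<in> U" for q
    using \<Psi>(2) that by (auto simp: lax_system_on_def D_z_eq_DD D_yb_eq_DD)
  have S: "S_sym \<Psi> J p = DD e_yb (A_y J ?M) p + DD e_z (A_z J ?M) p"
    by (simp add: S_sym_def D_z_eq_DD D_yb_eq_DD)
  show ?thesis
  proof (cases "lam = 0")
    case False
    have "DD e_yb (A_y J ?M) p = DD e_yb (\<lambda>q. cscale (1 / lam) (DD e_z ?M q)) p"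
      by (rule DD_cong[OF U p]) (use False in \<open>simp add: lax cscale_cscale\<close>)
    moreover have "DD e_z (A_z J ?M) p = DD e_z (\<lambda>q. cscale (- (1 / lam)) (DD e_yb ?M q)) p"
      by (rule DD_cong[OF U p]) (use False in \<open>simp add: lax cscale_cscale\<close>)
    ultimately show ?thesis
      unfolding S DD_cscale[OF mhol_DD[OF U M] p] DD_commute[OF U M p, of e_yb e_z]
      by (simp add: cscale_uminus)
  next
    case True
    \<comment> \<open>For \<open>lam = 0\<close> the derivatives of \<open>?M\<close> in z and yb
      vanish on U, hence so do all second derivatives involving them; only derivatives of the
      connection remain in \<open>S_sym\<close>.\<close>
    have 0: "DD e_z ?M q = 0" "DD e_yb ?M q = 0" if "q \<in> U" for q
      using lax[OF that] True by simp_all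
    have z: "DD w (DD u ?M) p = 0" if "u = e_z \<or> u = e_yb" for w u
      using DD_cong[OF U p, of "DD u ?M" "\<lambda>q. 0" w] 0 that by (auto simp: DD_const)
    have y: "DD e_yb (DD e_y ?M) p = 0"
      using DD_commute[OF U M p, of e_yb e_y] z[of e_yb e_y] by simp
    have "DD e_yb (A_y J ?M) p = mcomm (DD e_yb conn_y p) (?M p)"
      unfolding A_y_def D_y_eq_DD
      by (simp add: DD_add[OF mhol_DD[OF U M] mhol_mcomm[OF mhol_conn M] p] DD_mcomm[OF mhol_conn M p]
          y 0[OF p]) (simp add: mcomm_def)
    moreover have "DD e_z (A_z J ?M) p = mcomm (DD e_z conn_z p) (?M p)"
      unfolding A_z_def D_z_eq_DD
      by (simp add: DD_add[OF mhol_DD[OF U M] mhol_mcomm[OF mhol_conn M] p] DD_mcomm[OF mhol_conn M p]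
          z 0[OF p]) (simp add: mcomm_def)
    ultimately have "S_sym \<Psi> J p = mcomm (F_SDYM3 J p) (?M p)"
      by (simp add: S F_SDYM3_eq mcomm_add_left)
    then show ?thesis using or True p by (simp add: SDYM3_on_def mcomm_def)
  qed
qed

text \<open>The first variation of \<open>J^{-1} J_v\<close> is the covariant v-derivative of
  \<open>J^{-1} Q\<close>, here under a further derivative along w. At the fixed point p the left
  side is an explicit expression in \<alpha>, affine apart from the inverse, so its
  \<alpha>-derivative can be computed and compared term by term.\<close>

lemma has_mderiv_variation_conn:
  assumes Q: "mhol U Q" and p: "p \<in> U"
  shows "has_mderiv (\<lambda>\<alpha>. DD w (inv_times (\<lambda>q. J q + cscale \<alpha> (Q q)) (DD v (\<lambda>q. J q + cscale \<alpha> (Q q)))) p)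
    (DD w (\<lambda>q. DD v (inv_times J Q) q + mcomm (inv_times J (DD v J) q) (inv_times J Q q)) p) 0"
proof -
  let ?J = "\<lambda>\<alpha> q. J q + cscale \<alpha> (Q q)"
  let ?G = "\<lambda>\<alpha>. matrix_inv (?J \<alpha> p)"
  let ?D = "\<lambda>u \<alpha>. DD u J p + cscale \<alpha> (DD u Q p)"
  let ?DD = "\<lambda>\<alpha>. DD w (DD v J) p + cscale \<alpha> (DD w (DD v Q) p)"
  have Jp: "has_mderiv (\<lambda>\<alpha>. ?J \<alpha> p) (Q p) 0" by (rule has_mderiv_affine)
  have "isCont (\<lambda>\<alpha>. det (?J \<alpha> p)) 0"
    using has_field_derivative_det[OF Jp] by (rule DERIV_isCont)
  \<comment> \<open>The varied field is invertible at p for small \<alpha>, which suffices for a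
    derivative at \<alpha> = 0.\<close>
  then have ev: "\<forall>\<^sub>F \<alpha> in nhds 0. det (?J \<alpha> p) \<noteq> 0"
    using det_J[OF p] by (simp add: isCont_def tendsto_imp_eventually_ne eventually_nhds_conv_at)
  have mJ: "mhol U (?J \<alpha>)" for \<alpha> by (intro mhol_add mhol_J mhol_cscale Q)
  have DJ: "DD u (?J \<alpha>) q = DD u J q + cscale \<alpha> (DD u Q q)" if "q \<in> U" for u \<alpha> q
    by (simp add: DD_add[OF mhol_J mhol_cscale[OF Q] that] DD_cscale[OF Q that])
  have DDJ: "DD w (DD v (?J \<alpha>)) p = ?DD \<alpha>" for \<alpha>
    using DD_cong[OF U p, of "DD v (?J \<alpha>)" _ w, OF DJ]
    by (simp add: DD_add[OF mhol_DD[OF U mhol_J] mhol_cscale[OF mhol_DD[OF U Q]] p] DD_cscale[OF mhol_DD[OF U Q] p])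
  have eq: "DD w (inv_times (?J \<alpha>) (DD v (?J \<alpha>))) p
      = - (?G \<alpha> ** ?D w \<alpha> ** ?G \<alpha>) ** ?D v \<alpha> + ?G \<alpha> ** ?DD \<alpha>" if nz: "det (?J \<alpha> p) \<noteq> 0" for \<alpha>
  proof -
    \<comment> \<open>Away from p the varied field may be singular; the inverse is differentiated on
      the open set where the determinant is nonzero.\<close>
    define W where "W = U \<inter> (\<lambda>q. det (?J \<alpha> q)) -` (- {0})"
    have W: "open W"
      unfolding W_def by (intro continuous_open_preimage hol_continuous hol_det mJ U) auto
    have pW: "p \<in> W" and WU: "W \<subseteq> U" using p nz by (auto simp: W_def)
    have G: "mhol W (\<lambda>q. matrix_inv (?J \<alpha> q))"
      by (rule mhol_matrix_inv[OF W mhol_subset[OF mJ WU]]) (auto simp: W_def)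
    show ?thesis
      unfolding inv_times_eq
      by (simp add: DD_mult[OF G mhol_subset[OF mhol_DD[OF U mJ] WU] pW] DD_matrix_inv[OF mJ p nz] DJ[OF p] DDJ)
  qed
  have G: "has_mderiv ?G (- (matrix_inv (J p) ** Q p ** matrix_inv (J p))) 0"
    using has_mderiv_matrix_inv[OF Jp] det_J[OF p] by simp
  have mGQ: "mhol U (\<lambda>q. matrix_inv (J q) ** Q q)" by (intro mhol_mult mhol_J_inv Q)
  have A: "DD v (inv_times J Q) q + mcomm (inv_times J (DD v J) q) (inv_times J Q q)
      = matrix_inv (J q) ** DD v Q q - matrix_inv (J q) ** Q q ** (matrix_inv (J q) ** DD v J q)" if "q \<in> U" for q
    by (simp add: DD_inv_times[OF Q that]) (simp add: mcomm_def inv_times_eq matrix_mul_assoc)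
  have DA: "DD w (\<lambda>q. DD v (inv_times J Q) q + mcomm (inv_times J (DD v J) q) (inv_times J Q q)) p
    = DD w (\<lambda>q. matrix_inv (J q) ** DD v Q q - matrix_inv (J q) ** Q q ** (matrix_inv (J q) ** DD v J q)) p"
    by (rule DD_cong[OF U p A])
  have DA': "DD w (\<lambda>q. matrix_inv (J q) ** DD v Q q - matrix_inv (J q) ** Q q ** (matrix_inv (J q) ** DD v J q)) p
    = DD w (\<lambda>q. matrix_inv (J q)) p ** DD v Q p + matrix_inv (J p) ** DD w (DD v Q) p
     - ((DD w (\<lambda>q. matrix_inv (J q)) p ** Q p + matrix_inv (J p) ** DD w Q p) ** (matrix_inv (J p) ** DD v J p)
      + matrix_inv (J p) ** Q p ** (DD w (\<lambda>q. matrix_inv (J q)) p ** DD v J p + matrix_inv (J p) ** DD w (DD v J) p))"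
    using mhol_mult[OF mhol_J_inv mhol_DD[OF U Q, of v]] mhol_mult[OF mhol_J_inv mhol_DD[OF U mhol_J, of v]]
      mhol_DD[OF U Q, of v] mhol_DD[OF U mhol_J, of v]
    by (simp add: DD_diff[OF _ _ p] DD_mult[OF _ _ p] mhol_mult mGQ mhol_J_inv Q)
  have "has_mderiv (\<lambda>\<alpha>. - (?G \<alpha> ** ?D w \<alpha> ** ?G \<alpha>) ** ?D v \<alpha> + ?G \<alpha> ** ?DD \<alpha>)
    (DD w (\<lambda>q. DD v (inv_times J Q) q + mcomm (inv_times J (DD v J) q) (inv_times J Q q)) p) 0"
    using has_mderiv_add[OF has_mderiv_mult[OF has_mderiv_minus[OF has_mderiv_mult[OF has_mderiv_mult[OF G has_mderiv_affine] G]] has_mderiv_affine] has_mderiv_mult[OF G has_mderiv_affine],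
        of "DD w J p" "DD w Q p" "DD v J p" "DD v Q p" "DD w (DD v J) p" "DD w (DD v Q) p"]
    unfolding DA DA' DD_J_inv[OF p]
    by (simp add: matrix_ring_simps algebra_simps)
  then show ?thesis
    by (rule has_mderiv_cong_ev[rotated]) (use ev in \<open>rule eventually_mono\<close>, simp add: eq)
qed

text \<open>Links the two notions of symmetry: once \<open>S_sym\<close> vanishes, the equation is
  preserved to first order. It adds the variations of the y- and z-components of the
  connection.\<close>

lemma has_field_derivative_F_SDYM3_variation:
  assumes Q: "mhol U Q" and p: "p \<in> U"
  shows "((\<lambda>\<alpha>. F_SDYM3 (\<lambda>q. J q + cscale \<alpha> (Q q)) p $ i $ j) has_field_derivative S_sym Q J p $ i $ j) (at 0)"
  using has_mderiv_add[OF has_mderiv_variation_conn[OF assms, of e_yb e_y] has_mderiv_variation_conn[OF assms, of e_z e_z]]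
  unfolding has_mderiv_def F_SDYM3_def S_sym_def A_y_def A_z_def D_y_eq_DD D_z_eq_DD D_yb_eq_DD by blast

end

theorem mainTheorem4:
  fixes U :: "pt set" and J :: "'n::finite field_fun" and lam :: complex
  assumes "open U" and "SL_field_on U J"
  shows "(SDYM3_on U J \<longrightarrow> integrable_lax_system_on lam U J) \<and>
         (lam \<noteq> 0 \<and> integrable_lax_system_on lam U J \<longrightarrow> SDYM3_on U J) \<and>
         (\<forall>\<Psi>. holo_on U \<Psi> \<and> lax_system_on lam U J \<Psi> \<longrightarrow>
            (lam \<noteq> 0 \<or> SDYM3_on U J \<longrightarrow> (\<forall>p\<in>U. S_sym \<Psi> J p = 0)) \<and>
            (SDYM3_on U J \<longrightarrow> symmetry_characteristic_on U J \<Psi>))"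
proof (intro conjI allI impI)
  show "integrable_lax_system_on lam U J" if "SDYM3_on U J"
    using integrable_of_SDYM3[OF assms that] .
  show "SDYM3_on U J" if "lam \<noteq> 0 \<and> integrable_lax_system_on lam U J"
    using SDYM3_of_integrable[OF assms] that by blast
  fix \<Psi> assume "holo_on U \<Psi> \<and> lax_system_on lam U J \<Psi>"
  then have \<Psi>: "mhol U \<Psi>" "lax_system_on lam U J \<Psi>"
    using holo_on_iff_mhol[OF assms(1)] by auto
  show S: "\<forall>p\<in>U. S_sym \<Psi> J p = 0" if "lam \<noteq> 0 \<or> SDYM3_on U J"
    using S_sym_eq_0[OF assms \<Psi> that] by blast
  show "symmetry_characteristic_on U J \<Psi>" if "SDYM3_on U J"
    unfolding symmetry_characteristic_on_def
  proof (intro ballI allI)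
    fix p i j assume p: "p \<in> U"
    have "S_sym \<Psi> J p = 0" using S that p by blast
    then show "((\<lambda>\<alpha>. F_SDYM3 (\<lambda>q. J q + cscale \<alpha> (\<Psi> q)) p $ i $ j) has_field_derivative 0) (at 0)"
      using has_field_derivative_F_SDYM3_variation[OF assms \<Psi>(1) p, of i j] by simp
  qed
qed

end
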